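(* Every almost $\alpha$-paracosymplectic manifold $(M^{2n+1},\phi,\xi,\eta,g)$ with $n\geq 2$ is locally conformal to an almost paracosymplectic manifold. In other words, near each point $p\in M^{2n+1}$ there is defined a function $u$ such that the structure $(\phi',\xi',\eta',g')$ given by $$\phi'=\phi,\qquad \xi'=e^{2u}\xi,\qquad \eta'=e^{-2u}\eta,\qquad g'=e^{-2u}g$$ is almost paracosymplectic. The function $u$ is unique up to an additive constant, and $\alpha\eta=du$.
   Context: An almost paracontact metric manifold is a smooth manifold $M$ of dimension $2n+1$ with a $(1,1)$-tensor field $\phi$, a vector field $\xi$, a 1-form $\eta$ and a pseudo-Riemannian metric $g$ of signature $(n+1,n)$ such that $\eta(\xi)=1$, $\phi^2=\mathrm{Id}-\eta\otimes\xi$, the eigendistributions of $\phi|_{\ker\eta}$ for the eigenvalues $+1$ and $-1$ both have rank $n$, and $g(\phi X,\phi Y)=-g(X,Y)+\eta(X)\eta(Y)$. Its fundamental 2-form is $\Phi(X,Y)=g(\phi X,Y)$. It is almost $\alpha$-paracosymplectic, where $\alpha$ is a smooth function on $M$ (possibly constant), if $d\eta=0$ and $d\Phi=2\alpha\,\eta\wedge\Phi$ (with $d$ and $\wedge$ normalized compatibly, so that the cyclic sum of $(\nabla_X\Phi)(Y,Z)$ equals $2\alpha$ times the cyclic sum of $\eta(X)\Phi(Y,Z)$, $\nabla$ being the Levi-Civita connection). It is almost paracosymplectic if $d\eta=0$ and $d\Phi=0$. For an everywhere positive function $f$ on $M$, the conformal deformation of $(\phi,\xi,\eta,g)$ by $f$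 is defined here as the structure $\phi'=\phi$, $\xi'=\frac1f\xi$, $\eta'=f\eta$, $g'=fg$; the manifold with the structure $(\phi',\xi',\eta',g')$ is then called conformal to the one with $(\phi,\xi,\eta,g)$. Two structures on $M$ are called locally conformal if there is an open covering $(U_i)$ of $M$ such that their restrictions to each $U_i$ are conformal. The deformation in the claim is the case $f=e^{-2u}$.
   Formalization: Since g'(ξ',ξ')=e^{2u}, the deformed structure cannot satisfy the normalized compatibility unless u=0; "almost paracosymplectic" here requires g(φX,φY)=−g(X,Y)+g(ξ,ξ)η(X)η(Y) instead, with all other conditions kept. *)

theory Defs
  imports "HOL-Analysis.Analysis"
begin

text \<open>For open \<open>S\<close> in a finite-dimensional domain, \<open>Ck_on k S f\<close> says that \<open>f\<close> is
  of class \<open>C\<^sup>k\<close> on \<open>S\<close>.\<close>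

primrec Ck_on :: "nat \<Rightarrow> 'a::real_normed_vector set \<Rightarrow> ('a \<Rightarrow> 'b::real_normed_vector) \<Rightarrow> bool" where
  "Ck_on 0 S f = continuous_on S f"
| "Ck_on (Suc k) S f =
    ((\<forall>x\<in>S. f differentiable (at x)) \<and>
     (\<forall>v. Ck_on k S (\<lambda>x. frechet_derivative f (at x) v)))"

definition smooth_on :: "'a::real_normed_vector set \<Rightarrow> ('a \<Rightarrow> 'b::real_normed_vector) \<Rightarrow> bool" where
  "smooth_on S f \<longleftrightarrow> (\<forall>k. Ck_on k S f)"

text \<open>A chart is a pair of its domain and its coordinate map.\<close>

type_synonym ('m, 'e) chart = "'m set \<times> ('m \<Rightarrow> 'e)"

abbreviation chart_dom :: "('m, 'e) chart \<Rightarrow> 'm set" where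
  "chart_dom \<equiv> fst"

abbreviation chart_map :: "('m, 'e) chart \<Rightarrow> 'm \<Rightarrow> 'e" where
  "chart_map \<equiv> snd"

definition chart_inv :: "('m, 'e) chart \<Rightarrow> 'e \<Rightarrow> 'm" where
  "chart_inv c = the_inv_into (chart_dom c) (chart_map c)"

text \<open>The atlas need not be maximal: smooth functions and smooth tensor fields with respect to
  an atlas are the same as those with respect to the maximal atlas containing it.\<close>

definition smooth_atlas ::
    "('m::{t2_space,second_countable_topology}, 'e::euclidean_space) chart set \<Rightarrow> bool" where
  "smooth_atlas A \<longleftrightarrow>
    (\<Union>c\<in>A. chart_dom c) = UNIV \<and>
    (\<forall>c\<in>A. open (chart_dom c) \<and> open (chart_map c ` chart_dom c) \<and>
       homeomorphism (chart_dom c) (chart_map c ` chart_dom c) (chart_map c) (chart_inv c)) \<and>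
    (\<forall>c\<in>A. \<forall>c'\<in>A.
       smooth_on (chart_map c ` (chart_dom c \<inter> chart_dom c')) (chart_map c' \<circ> chart_inv c))"

definition transition_deriv ::
    "('m, 'e::euclidean_space) chart \<Rightarrow> ('m, 'e) chart \<Rightarrow> 'm \<Rightarrow> 'e \<Rightarrow> 'e" where
  "transition_deriv c c' p = frechet_derivative (chart_map c' \<circ> chart_inv c) (at (chart_map c p))"

text \<open>A field is given by its components: \<open>T c p\<close> is the coordinate expression, in the chart
  \<open>c\<close>, of the tensor at the point \<open>p\<close> of the domain of \<open>c\<close>. The expressions in different
  charts are related by the usual transformation laws. Everything is relative to an open set
  \<open>U\<close>, regarded as an open submanifold; \<open>U = UNIV\<close> is the whole manifold.\<close>

type_synonym ('m, 'e, 'b) components = "('m, 'e) chart \<Rightarrow> 'm \<Rightarrow> 'b"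

definition smooth_components ::
    "('m, 'e::euclidean_space) chart set \<Rightarrow> 'm set \<Rightarrow>
     ('m, 'e, 'b::real_normed_vector) components \<Rightarrow> bool" where
  "smooth_components A U T \<longleftrightarrow>
    (\<forall>c\<in>A. smooth_on (chart_map c ` (U \<inter> chart_dom c)) (\<lambda>x. T c (chart_inv c x)))"

definition smooth_function ::
    "('m, 'e::euclidean_space) chart set \<Rightarrow> 'm set \<Rightarrow> ('m \<Rightarrow> real) \<Rightarrow> bool" where
  "smooth_function A U f \<longleftrightarrow> smooth_components A U (\<lambda>_. f)"

definition vector_field ::
    "('m, 'e::euclidean_space) chart set \<Rightarrow> 'm set \<Rightarrow> ('m, 'e, 'e) components \<Rightarrow> bool" where
  "vector_field A U X \<longleftrightarrow> smooth_components A U X \<and>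
    (\<forall>c\<in>A. \<forall>c'\<in>A. \<forall>p\<in>U \<inter> chart_dom c \<inter> chart_dom c'.
       X c' p = transition_deriv c c' p (X c p))"

definition one_form ::
    "('m, 'e::euclidean_space) chart set \<Rightarrow> 'm set \<Rightarrow>
     ('m, 'e, 'e \<Rightarrow>\<^sub>L real) components \<Rightarrow> bool" where
  "one_form A U \<omega> \<longleftrightarrow> smooth_components A U \<omega> \<and>
    (\<forall>c\<in>A. \<forall>c'\<in>A. \<forall>p\<in>U \<inter> chart_dom c \<inter> chart_dom c'. \<forall>v.
       blinfun_apply (\<omega> c' p) (transition_deriv c c' p v) = blinfun_apply (\<omega> c p) v)"

definition endomorphism_field ::
    "('m, 'e::euclidean_space) chart set \<Rightarrow> 'm set \<Rightarrow>
     ('m, 'e, 'e \<Rightarrow>\<^sub>L 'e) components \<Rightarrow> bool" where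
  "endomorphism_field A U F \<longleftrightarrow> smooth_components A U F \<and>
    (\<forall>c\<in>A. \<forall>c'\<in>A. \<forall>p\<in>U \<inter> chart_dom c \<inter> chart_dom c'. \<forall>v.
       blinfun_apply (F c' p) (transition_deriv c c' p v) =
       transition_deriv c c' p (blinfun_apply (F c p) v))"

definition bilinear_field ::
    "('m, 'e::euclidean_space) chart set \<Rightarrow> 'm set \<Rightarrow>
     ('m, 'e, 'e \<Rightarrow>\<^sub>L 'e \<Rightarrow>\<^sub>L real) components \<Rightarrow> bool" where
  "bilinear_field A U B \<longleftrightarrow> smooth_components A U B \<and>
    (\<forall>c\<in>A. \<forall>c'\<in>A. \<forall>p\<in>U \<inter> chart_dom c \<inter> chart_dom c'. \<forall>v w.
       blinfun_apply (blinfun_apply (B c' p) (transition_deriv c c' p v))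
         (transition_deriv c c' p w) =
       blinfun_apply (blinfun_apply (B c p) v) w)"

definition has_signature :: "('e::euclidean_space \<Rightarrow>\<^sub>L 'e \<Rightarrow>\<^sub>L real) \<Rightarrow> nat \<Rightarrow> nat \<Rightarrow> bool" where
  "has_signature B r s \<longleftrightarrow>
    (\<exists>P N. subspace P \<and> subspace N \<and> dim P = r \<and> dim N = s \<and> span (P \<union> N) = UNIV \<and>
       (\<forall>v\<in>P. v \<noteq> 0 \<longrightarrow> blinfun_apply (blinfun_apply B v) v > 0) \<and>
       (\<forall>w\<in>N. w \<noteq> 0 \<longrightarrow> blinfun_apply (blinfun_apply B w) w < 0) \<and>
       (\<forall>v\<in>P. \<forall>w\<in>N. blinfun_apply (blinfun_apply B v) w = 0))"

definition pseudo_riemannian_metric ::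
    "('m, 'e::euclidean_space) chart set \<Rightarrow> 'm set \<Rightarrow> nat \<Rightarrow> nat \<Rightarrow>
     ('m, 'e, 'e \<Rightarrow>\<^sub>L 'e \<Rightarrow>\<^sub>L real) components \<Rightarrow> bool" where
  "pseudo_riemannian_metric A U r s g \<longleftrightarrow> bilinear_field A U g \<and>
    (\<forall>c\<in>A. \<forall>p\<in>U \<inter> chart_dom c.
       (\<forall>v w. blinfun_apply (blinfun_apply (g c p) v) w =
              blinfun_apply (blinfun_apply (g c p) w) v) \<and>
       has_signature (g c p) r s)"

definition coord_deriv ::
    "('m, 'e::euclidean_space) chart \<Rightarrow> ('m, 'e, 'b::real_normed_vector) components \<Rightarrow>
     'm \<Rightarrow> 'e \<Rightarrow> 'b" where
  "coord_deriv c T p v = frechet_derivative (\<lambda>x. T c (chart_inv c x)) (at (chart_map c p)) v"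

definition differential ::
    "('m \<Rightarrow> real) \<Rightarrow> ('m, 'e::euclidean_space) chart \<Rightarrow> 'm \<Rightarrow> 'e \<Rightarrow> real" where
  "differential u c p v = coord_deriv c (\<lambda>_. u) p v"

text \<open>The exterior derivative and the wedge product carry no combinatorial factors; for a
  torsion-free connection the derivative of a 2-form is then the cyclic sum of its covariant
  derivatives.\<close>

definition ext_deriv1 ::
    "('m, 'e, 'e \<Rightarrow>\<^sub>L real) components \<Rightarrow>
     ('m, 'e::euclidean_space) chart \<Rightarrow> 'm \<Rightarrow> 'e \<Rightarrow> 'e \<Rightarrow> real" where
  "ext_deriv1 \<omega> c p v w =
     blinfun_apply (coord_deriv c \<omega> p v) w - blinfun_apply (coord_deriv c \<omega> p w) v"

definition ext_deriv2 ::
    "('m, 'e, 'e \<Rightarrow>\<^sub>L 'e \<Rightarrow>\<^sub>L real) components \<Rightarrow>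
     ('m, 'e::euclidean_space) chart \<Rightarrow> 'm \<Rightarrow> 'e \<Rightarrow> 'e \<Rightarrow> 'e \<Rightarrow> real" where
  "ext_deriv2 \<Psi> c p x y z =
     blinfun_apply (blinfun_apply (coord_deriv c \<Psi> p x) y) z +
     blinfun_apply (blinfun_apply (coord_deriv c \<Psi> p y) z) x +
     blinfun_apply (blinfun_apply (coord_deriv c \<Psi> p z) x) y"

definition wedge12 ::
    "('m, 'e, 'e \<Rightarrow>\<^sub>L real) components \<Rightarrow> ('m, 'e, 'e \<Rightarrow>\<^sub>L 'e \<Rightarrow>\<^sub>L real) components \<Rightarrow>
     ('m, 'e::euclidean_space) chart \<Rightarrow> 'm \<Rightarrow> 'e \<Rightarrow> 'e \<Rightarrow> 'e \<Rightarrow> real" where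
  "wedge12 \<omega> \<Psi> c p x y z =
     blinfun_apply (\<omega> c p) x * blinfun_apply (blinfun_apply (\<Psi> c p) y) z +
     blinfun_apply (\<omega> c p) y * blinfun_apply (blinfun_apply (\<Psi> c p) z) x +
     blinfun_apply (\<omega> c p) z * blinfun_apply (blinfun_apply (\<Psi> c p) x) y"

record (overloaded) ('m, 'e) paracontact_data =
  phi :: "('m, 'e, 'e::euclidean_space \<Rightarrow>\<^sub>L 'e) components"
  xi  :: "('m, 'e, 'e) components"
  eta :: "('m, 'e, 'e \<Rightarrow>\<^sub>L real) components"
  met :: "('m, 'e, 'e \<Rightarrow>\<^sub>L 'e \<Rightarrow>\<^sub>L real) components"

definition fundamental_form ::
    "('m, 'e::euclidean_space) paracontact_data \<Rightarrow>
     ('m, 'e, 'e \<Rightarrow>\<^sub>L 'e \<Rightarrow>\<^sub>L real) components" where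
  "fundamental_form S c p = met S c p o\<^sub>L phi S c p"

definition almost_paracontact ::
    "('m, 'e::euclidean_space) chart set \<Rightarrow> nat \<Rightarrow> 'm set \<Rightarrow> ('m, 'e) paracontact_data \<Rightarrow> bool" where
  "almost_paracontact A n U S \<longleftrightarrow>
    endomorphism_field A U (phi S) \<and> vector_field A U (xi S) \<and> one_form A U (eta S) \<and>
    (\<forall>c\<in>A. \<forall>p\<in>U \<inter> chart_dom c.
       blinfun_apply (eta S c p) (xi S c p) = 1 \<and>
       (\<forall>v. blinfun_apply (phi S c p) (blinfun_apply (phi S c p) v) =
            v - blinfun_apply (eta S c p) v *\<^sub>R xi S c p) \<and>
       dim {v. blinfun_apply (eta S c p) v = 0 \<and> blinfun_apply (phi S c p) v = v} = n \<and>
       dim {v. blinfun_apply (eta S c p) v = 0 \<and> blinfun_apply (phi S c p) v = - v} = n)"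

definition almost_paracontact_metric ::
    "('m, 'e::euclidean_space) chart set \<Rightarrow> nat \<Rightarrow> 'm set \<Rightarrow> ('m, 'e) paracontact_data \<Rightarrow> bool" where
  "almost_paracontact_metric A n U S \<longleftrightarrow>
    almost_paracontact A n U S \<and> pseudo_riemannian_metric A U (n + 1) n (met S) \<and>
    (\<forall>c\<in>A. \<forall>p\<in>U \<inter> chart_dom c. \<forall>v w.
       blinfun_apply (blinfun_apply (met S c p) (blinfun_apply (phi S c p) v))
         (blinfun_apply (phi S c p) w) =
       - blinfun_apply (blinfun_apply (met S c p) v) w +
       blinfun_apply (eta S c p) v * blinfun_apply (eta S c p) w)"

definition almost_alpha_paracosymplectic ::
    "('m, 'e::euclidean_space) chart set \<Rightarrow> nat \<Rightarrow> 'm set \<Rightarrow> ('m \<Rightarrow> real) \<Rightarrow>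
     ('m, 'e) paracontact_data \<Rightarrow> bool" where
  "almost_alpha_paracosymplectic A n U \<alpha> S \<longleftrightarrow>
    almost_paracontact_metric A n U S \<and> smooth_function A U \<alpha> \<and>
    (\<forall>c\<in>A. \<forall>p\<in>U \<inter> chart_dom c.
       (\<forall>v w. ext_deriv1 (eta S) c p v w = 0) \<and>
       (\<forall>x y z. ext_deriv2 (fundamental_form S) c p x y z =
          2 * \<alpha> p * wedge12 (eta S) (fundamental_form S) c p x y z))"

text \<open>A conformal deformation multiplies both \<open>\<eta>\<close> and \<open>g\<close> by \<open>f\<close>, so that
  \<open>g'(\<xi>', \<xi>') = 1 / f\<close>, and the compatibility condition
  \<open>g(\<phi> X, \<phi> Y) = - g(X, Y) + \<eta>(X) \<eta>(Y)\<close>, which forces \<open>g(\<xi>, \<xi>) = 1\<close>, cannot survive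
  unless \<open>f = 1\<close>. The structures called almost paracosymplectic below are therefore required
  to satisfy the condition without the normalization of \<open>\<xi>\<close>, namely
  \<open>g(\<phi> X, \<phi> Y) = - g(X, Y) + g(\<xi>, \<xi>) \<eta>(X) \<eta>(Y)\<close>; with \<open>g(\<xi>, \<xi>) = 1\<close> this is the
  original condition.\<close>

definition almost_paracosymplectic ::
    "('m, 'e::euclidean_space) chart set \<Rightarrow> nat \<Rightarrow> 'm set \<Rightarrow> ('m, 'e) paracontact_data \<Rightarrow> bool" where
  "almost_paracosymplectic A n U S \<longleftrightarrow>
    almost_paracontact A n U S \<and> pseudo_riemannian_metric A U (n + 1) n (met S) \<and>
    (\<forall>c\<in>A. \<forall>p\<in>U \<inter> chart_dom c.
       (\<forall>v w. blinfun_apply (blinfun_apply (met S c p) (blinfun_apply (phi S c p) v))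
                (blinfun_apply (phi S c p) w) =
              - blinfun_apply (blinfun_apply (met S c p) v) w +
              blinfun_apply (blinfun_apply (met S c p) (xi S c p)) (xi S c p) *
              (blinfun_apply (eta S c p) v * blinfun_apply (eta S c p) w)) \<and>
       (\<forall>v w. ext_deriv1 (eta S) c p v w = 0) \<and>
       (\<forall>x y z. ext_deriv2 (fundamental_form S) c p x y z = 0))"

definition conformal_deformation ::
    "('m \<Rightarrow> real) \<Rightarrow> ('m, 'e::euclidean_space) paracontact_data \<Rightarrow> ('m, 'e) paracontact_data" where
  "conformal_deformation f S =
    \<lparr>phi = phi S,
     xi = (\<lambda>c p. (1 / f p) *\<^sub>R xi S c p),
     eta = (\<lambda>c p. f p *\<^sub>R eta S c p),
     met = (\<lambda>c p. f p *\<^sub>R met S c p)\<rparr>"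

definition conformal ::
    "('m, 'e::euclidean_space) chart set \<Rightarrow> 'm set \<Rightarrow>
     ('m, 'e) paracontact_data \<Rightarrow> ('m, 'e) paracontact_data \<Rightarrow> bool" where
  "conformal A U S S' \<longleftrightarrow>
    (\<exists>f. smooth_function A U f \<and> (\<forall>p\<in>U. f p > 0) \<and>
       (\<forall>c\<in>A. \<forall>p\<in>U \<inter> chart_dom c.
          phi S' c p = phi S c p \<and> xi S' c p = (1 / f p) *\<^sub>R xi S c p \<and>
          eta S' c p = f p *\<^sub>R eta S c p \<and> met S' c p = f p *\<^sub>R met S c p))"

text \<open>The almost paracosymplectic structures live on the members of the covering only; they
  need not be restrictions of one structure on the whole manifold.\<close>

definition locally_conformal_to_almost_paracosymplectic ::
    "('m::topological_space, 'e::euclidean_space) chart set \<Rightarrow> nat \<Rightarrow>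
     ('m, 'e) paracontact_data \<Rightarrow> bool" where
  "locally_conformal_to_almost_paracosymplectic A n S \<longleftrightarrow>
    (\<exists>\<U>. (\<forall>U\<in>\<U>. open U) \<and> \<Union>\<U> = UNIV \<and>
       (\<forall>U\<in>\<U>. \<exists>S'. almost_paracosymplectic A n U S' \<and> conformal A U S S'))"

definition paracosymplectic_potential ::
    "('m, 'e::euclidean_space) chart set \<Rightarrow> nat \<Rightarrow> ('m, 'e) paracontact_data \<Rightarrow>
     'm set \<Rightarrow> ('m \<Rightarrow> real) \<Rightarrow> bool" where
  "paracosymplectic_potential A n S U u \<longleftrightarrow>
    smooth_function A U u \<and>
    almost_paracosymplectic A n U (conformal_deformation (\<lambda>p. exp (- 2 * u p)) S)"

end

theory Submission
  imports Defs
begin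

text \<open>The 1-form \<open>\<alpha> \<eta>\<close> is the Lee form of the structure, and everything follows from two facts
  about it: it is closed, and its primitives are exactly the potentials \<open>u\<close>.

  Both rest on a piece of linear algebra (\<open>wedge_eq_zero_imp_zero\<close>). At each point the fundamental
  form \<open>\<Phi>\<close> has the line spanned by \<open>\<xi>\<close> as its kernel, so for \<open>n \<ge> 2\<close> its rank \<open>2 n\<close> is at
  least 4, and \<open>\<beta> \<and> \<Phi> = 0\<close> forces \<open>\<beta> = 0\<close> for a 1-form \<open>\<beta>\<close>.

  Deforming by \<open>f = exp (- 2 u)\<close> gives \<open>d (f \<eta>) = - 2 f du \<and> \<eta>\<close> and
  \<open>d (f \<Phi>) = 2 f (\<alpha> \<eta> - du) \<and> \<Phi>\<close>. By the linear algebra the deformed structure is almost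
  paracosymplectic if and only if \<open>du = \<alpha> \<eta>\<close> (\<open>paracosymplectic_potential_iff\<close>). This contains
  the formula for \<open>du\<close>, and it shows that on a connected open set two potentials differ by a
  constant and that adding a constant to a potential gives a potential.

  For existence, the exterior derivative of \<open>d\<Phi> = 2 \<alpha> \<eta> \<and> \<Phi>\<close> reads
  \<open>d\<alpha> \<and> \<eta> \<and> \<Phi> = 0\<close> (\<open>d_alpha_wedge_eta_wedge_fundamental\<close>; this needs the symmetry of second
  derivatives). Contracting with \<open>\<xi>\<close> and applying the linear algebra once more, one finds
  \<open>d\<alpha> = d\<alpha>(\<xi>) \<eta>\<close> (\<open>d_alpha_proportional_eta\<close>). Hence \<open>d (\<alpha> \<eta>) = d\<alpha> \<and> \<eta> = 0\<close>, and the
  Poincare lemma (\<open>poincare_convex\<close>) on a coordinate ball yields a primitive \<open>u\<close>.\<close>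

section \<open>Calculus of smooth maps\<close>

text \<open>Since \<^const>\<open>frechet_derivative\<close> is a choice operator, its values are controlled only
  where the derivative exists. On an open set two maps that agree have the same derivatives, which
  makes it harmless to compute with any explicit derivative instead.\<close>

lemma Ck_on_cong:
  assumes "open S" "\<And>x. x \<in> S \<Longrightarrow> f x = g x" "Ck_on k S f"
  shows "Ck_on k S g"
  using assms(2,3)
proof (induction k arbitrary: f g)
  case 0
  then show ?case using continuous_on_cong by (metis Ck_on.simps(1))
next
  case (Suc k)
  have der: "(g has_derivative frechet_derivative f (at x)) (at x)" if "x \<in> S" for x
  proof -
    have "(f has_derivative frechet_derivative f (at x)) (at x)"
      using Suc.prems(2) that frechet_derivative_works by auto
    then show ?thesis
      using has_derivative_transform_within_open[OF _ assms(1) that] Suc.prems(1) by blast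
  qed
  have "Ck_on k S (\<lambda>x. frechet_derivative g (at x) v)" for v
  proof (rule Suc.IH)
    show "Ck_on k S (\<lambda>x. frechet_derivative f (at x) v)"
      using Suc.prems(2) by simp
    show "frechet_derivative f (at x) v = frechet_derivative g (at x) v" if "x \<in> S" for x
      using frechet_derivative_at[OF der[OF that]] by simp
  qed
  then show ?case
    using der by (auto simp: differentiable_def)
qed

lemma Ck_on_subset: "Ck_on k S f \<Longrightarrow> T \<subseteq> S \<Longrightarrow> Ck_on k T f"
  by (induction k arbitrary: f) (auto intro: continuous_on_subset)

lemma Ck_on_SucD: "Ck_on (Suc k) S f \<Longrightarrow> Ck_on k S f"
proof (induction k arbitrary: f)
  case 0
  then show ?case
    by (auto intro!: continuous_at_imp_continuous_on differentiable_imp_continuous_within)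
next
  case (Suc k)
  then show ?case by (metis Ck_on.simps(2))
qed

lemma Ck_on_Suc_I:
  assumes "open S" "\<And>x. x \<in> S \<Longrightarrow> (f has_derivative f' x) (at x)"
    "\<And>v. Ck_on k S (\<lambda>x. f' x v)"
  shows "Ck_on (Suc k) S f"
proof -
  have "Ck_on k S (\<lambda>x. frechet_derivative f (at x) v)" for v
    by (rule Ck_on_cong[OF assms(1) _ assms(3)[of v]]) (metis assms(2) frechet_derivative_at)
  then show ?thesis using assms(2) by (auto simp: differentiable_def)
qed

lemma Ck_on_const: "Ck_on k S (\<lambda>_. a)"
  by (induction k arbitrary: a) auto

lemma Ck_on_add:
  assumes "open S" "Ck_on k S f" "Ck_on k S g"
  shows "Ck_on k S (\<lambda>x. f x + g x)"
  using assms(2,3)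
proof (induction k arbitrary: f g)
  case 0
  then show ?case by (auto intro: continuous_on_add)
next
  case (Suc k)
  show ?case
    by (rule Ck_on_Suc_I[OF assms(1), where f' = "\<lambda>x v. frechet_derivative f (at x) v + frechet_derivative g (at x) v"])
      (use Suc in \<open>auto intro!: has_derivative_add simp: frechet_derivative_works\<close>)
qed

lemma (in bounded_bilinear) Ck_on:
  fixes f :: "'d::real_normed_vector \<Rightarrow> 'a"
  assumes "open S" "Ck_on k S f" "Ck_on k S g"
  shows "Ck_on k S (\<lambda>x. prod (f x) (g x))"
  using assms(2,3)
proof (induction k arbitrary: f g)
  case 0
  then show ?case by (auto intro: continuous_on)
next
  case (Suc k)
  show ?case
  proof (rule Ck_on_Suc_I[OF assms(1)])
    show "((\<lambda>x. prod (f x) (g x)) has_derivative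
        (\<lambda>v. prod (f x) (frechet_derivative g (at x) v) + prod (frechet_derivative f (at x) v) (g x))) (at x)"
      if "x \<in> S" for x
      using Suc.prems that by (intro FDERIV) (auto simp: frechet_derivative_works)
    show "Ck_on k S (\<lambda>x. prod (f x) (frechet_derivative g (at x) v) +
        prod (frechet_derivative f (at x) v) (g x))" for v
      using Suc.prems Ck_on_SucD[OF Suc.prems(1)] Ck_on_SucD[OF Suc.prems(2)]
      by (intro Ck_on_add[OF assms(1)] Suc.IH) auto
  qed
qed

lemma Ck_on_exp:
  fixes f :: "'a::real_normed_vector \<Rightarrow> real"
  assumes "open S" "Ck_on k S f"
  shows "Ck_on k S (\<lambda>x. exp (f x))"
  using assms(2)
proof (induction k)
  case 0
  then show ?case by (auto intro: continuous_on_exp)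
next
  case (Suc k)
  show ?case
  proof (rule Ck_on_Suc_I[OF assms(1)])
    show "((\<lambda>x. exp (f x)) has_derivative (\<lambda>v. exp (f x) * frechet_derivative f (at x) v)) (at x)"
      if "x \<in> S" for x
      using Suc.prems that frechet_derivative_works[of f "at x"]
      by (auto intro!: derivative_eq_intros)
    show "Ck_on k S (\<lambda>x. exp (f x) * frechet_derivative f (at x) v)" for v
      using Suc Ck_on_SucD[OF Suc.prems]
      by (intro bounded_bilinear.Ck_on[OF bounded_bilinear_mult assms(1)]) auto
  qed
qed

lemma smooth_on_cong:
  "open S \<Longrightarrow> (\<And>x. x \<in> S \<Longrightarrow> f x = g x) \<Longrightarrow> smooth_on S f \<Longrightarrow> smooth_on S g"
  unfolding smooth_on_def using Ck_on_cong by blast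

lemma smooth_on_subset: "smooth_on S f \<Longrightarrow> T \<subseteq> S \<Longrightarrow> smooth_on T f"
  unfolding smooth_on_def using Ck_on_subset by blast

lemma smooth_on_const: "smooth_on S (\<lambda>_. a)"
  unfolding smooth_on_def using Ck_on_const by blast

lemma (in bounded_bilinear) smooth_on:
  "open S \<Longrightarrow> smooth_on S f \<Longrightarrow> smooth_on S g \<Longrightarrow> smooth_on S (\<lambda>x. prod (f x) (g x))"
  unfolding smooth_on_def using Ck_on by blast

lemma smooth_on_exp:
  fixes f :: "'a::real_normed_vector \<Rightarrow> real"
  shows "open S \<Longrightarrow> smooth_on S f \<Longrightarrow> smooth_on S (\<lambda>x. exp (f x))"
  unfolding smooth_on_def using Ck_on_exp by blast

lemma smooth_on_has_derivative:
  "smooth_on S f \<Longrightarrow> x \<in> S \<Longrightarrow> (f has_derivative frechet_derivative f (at x)) (at x)"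
  unfolding smooth_on_def using frechet_derivative_works Ck_on.simps(2) by blast

lemma smooth_on_deriv: "smooth_on S f \<Longrightarrow> smooth_on S (\<lambda>x. frechet_derivative f (at x) v)"
  unfolding smooth_on_def using Ck_on.simps(2) by blast

lemma smooth_on_imp_continuous_on: "smooth_on S f \<Longrightarrow> continuous_on S f"
  unfolding smooth_on_def using Ck_on.simps(1) by blast

text \<open>A function with smooth derivative is smooth. For a local potential of a smooth 1-form this
  gives smoothness in every chart without any composition rule for smooth maps.\<close>

lemma smooth_on_antiderivative:
  assumes "open S" "\<And>x. x \<in> S \<Longrightarrow> (f has_derivative f' x) (at x)"
    "\<And>v. smooth_on S (\<lambda>x. f' x v)"
  shows "smooth_on S f"
  unfolding smooth_on_def
  using Ck_on_SucD[OF Ck_on_Suc_I[OF assms(1,2)]] assms(3) unfolding smooth_on_def by blast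

lemma smooth_on_blinfun_apply:
  "open S \<Longrightarrow> smooth_on S f \<Longrightarrow> smooth_on S (\<lambda>x. blinfun_apply (f x) v)"
  by (rule bounded_bilinear.smooth_on[OF bounded_bilinear_blinfun_apply]) (auto intro: smooth_on_const)

lemma frechet_derivative_blinfun_apply:
  assumes "smooth_on S f" "x \<in> S"
  shows "frechet_derivative (\<lambda>x. blinfun_apply (f x) y) (at x) v =
    blinfun_apply (frechet_derivative f (at x) v) y"
proof -
  have "((\<lambda>x. blinfun_apply (f x) y) has_derivative
      (\<lambda>v. blinfun_apply (frechet_derivative f (at x) v) y)) (at x)"
    by (rule bounded_linear.has_derivative[OF bounded_bilinear.bounded_linear_left[OF bounded_bilinear_blinfun_apply]])
      (rule smooth_on_has_derivative[OF assms])
  from frechet_derivative_at[OF this] show ?thesis by (metis)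
qed


text \<open>The mixed second difference is symmetric in the two directions, and two applications of
  the mean value theorem express it by a mixed second derivative at a nearby point. Comparing both
  expressions on shrinking parallelograms yields the symmetry of second derivatives.\<close>

lemma second_difference:
  fixes f :: "'a::real_normed_vector \<Rightarrow> real"
  assumes f: "\<And>y. y \<in> S \<Longrightarrow> (f has_derivative F y) (at y)"
    and G: "\<And>y. y \<in> S \<Longrightarrow> ((\<lambda>y. F y v) has_derivative G y) (at y)"
    and h: "0 < h"
    and S: "\<And>s t. s \<in> {0..h} \<Longrightarrow> t \<in> {0..h} \<Longrightarrow> x + s *\<^sub>R v + t *\<^sub>R w \<in> S"
  obtains s t where "s \<in> {0..h}" "t \<in> {0..h}"
    "f (x + h *\<^sub>R v + h *\<^sub>R w) - f (x + h *\<^sub>R v) - f (x + h *\<^sub>R w) + f x =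
     h * h * G (x + s *\<^sub>R v + t *\<^sub>R w) w"
proof -
  define A where "A s = f (x + s *\<^sub>R v + h *\<^sub>R w) - f (x + s *\<^sub>R v)" for s
  have dA: "(A has_derivative (\<lambda>r. F (x + s *\<^sub>R v + h *\<^sub>R w) (r *\<^sub>R v) - F (x + s *\<^sub>R v) (r *\<^sub>R v)))
      (at s within {0..h})" if "s \<in> {0..h}" for s
  proof -
    have 1: "x + s *\<^sub>R v + h *\<^sub>R w \<in> S" using S[of s h] that h by auto
    have 2: "x + s *\<^sub>R v \<in> S" using S[of s 0] that h by auto
    have "((\<lambda>s. x + s *\<^sub>R v + h *\<^sub>R w) has_derivative (\<lambda>r. r *\<^sub>R v)) (at s within {0..h})"
      "((\<lambda>s. x + s *\<^sub>R v) has_derivative (\<lambda>r. r *\<^sub>R v)) (at s within {0..h})"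
      by (auto intro!: derivative_eq_intros)
    from has_derivative_diff[OF has_derivative_compose[OF this(1) f[OF 1]]
        has_derivative_compose[OF this(2) f[OF 2]]]
    show ?thesis unfolding A_def .
  qed
  obtain s where s: "s \<in> {0<..<h}"
    and As: "A h - A 0 = F (x + s *\<^sub>R v + h *\<^sub>R w) (h *\<^sub>R v) - F (x + s *\<^sub>R v) (h *\<^sub>R v)"
    using mvt_simple[OF h, of A, OF dA] by auto
  define B where "B t = F (x + s *\<^sub>R v + t *\<^sub>R w) v" for t
  have dB: "(B has_derivative (\<lambda>r. G (x + s *\<^sub>R v + t *\<^sub>R w) (r *\<^sub>R w))) (at t within {0..h})"
    if "t \<in> {0..h}" for t
  proof -
    have 1: "x + s *\<^sub>R v + t *\<^sub>R w \<in> S" using S[of s t] that s by auto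
    have "((\<lambda>t. x + s *\<^sub>R v + t *\<^sub>R w) has_derivative (\<lambda>r. r *\<^sub>R w)) (at t within {0..h})"
      by (auto intro!: derivative_eq_intros)
    from has_derivative_compose[OF this G[OF 1]] show ?thesis unfolding B_def .
  qed
  obtain t where t: "t \<in> {0<..<h}" and Bt: "B h - B 0 = G (x + s *\<^sub>R v + t *\<^sub>R w) (h *\<^sub>R w)"
    using mvt_simple[OF h, of B, OF dB] by auto
  have lin: "linear (F y)" "linear (G y)" if "y \<in> S" for y
    using f[OF that] G[OF that] has_derivative_linear by auto
  have mem: "x + s *\<^sub>R v + h *\<^sub>R w \<in> S" "x + s *\<^sub>R v \<in> S" "x + s *\<^sub>R v + t *\<^sub>R w \<in> S"
    using S[of s h] S[of s 0] S[of s t] s t by auto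
  have "A h - A 0 = h * (B h - B 0)"
    using As unfolding B_def
    by (simp add: linear_cmul[OF lin(1)] mem right_diff_distrib)
  also have "\<dots> = h * h * G (x + s *\<^sub>R v + t *\<^sub>R w) w"
    using Bt by (simp add: linear_cmul[OF lin(2)] mem)
  finally show thesis
    using that[of s t] s t unfolding A_def by (auto simp: algebra_simps)
qed

lemma second_derivative_symmetric:
  fixes f :: "'a::real_normed_vector \<Rightarrow> real"
  assumes "open S" "x \<in> S"
    and f: "\<And>y. y \<in> S \<Longrightarrow> (f has_derivative F y) (at y)"
    and Fv: "\<And>y. y \<in> S \<Longrightarrow> ((\<lambda>y. F y v) has_derivative G y) (at y)"
    and Fw: "\<And>y. y \<in> S \<Longrightarrow> ((\<lambda>y. F y w) has_derivative H y) (at y)"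
    and contG: "continuous_on S (\<lambda>y. G y w)" and contH: "continuous_on S (\<lambda>y. H y v)"
  shows "G x w = H x v"
proof -
  obtain e where e: "e > 0" "ball x e \<subseteq> S"
    using assms(1,2) openE by blast
  \<comment> \<open>All parallelograms at \<open>x\<close> with sides \<open>s v\<close>, \<open>t w\<close> for \<open>s, t < d\<close> stay inside the ball.\<close>
  define d where "d = e / (norm v + norm w + 1)"
  have d: "d > 0" using e by (simp add: d_def add_nonneg_pos)
  have inS: "x + s *\<^sub>R v + t *\<^sub>R w \<in> S" if "s \<in> {0..<d}" "t \<in> {0..<d}" for s t
  proof -
    have "norm (s *\<^sub>R v + t *\<^sub>R w) \<le> s * norm v + t * norm w"
      using norm_triangle_ineq[of "s *\<^sub>R v" "t *\<^sub>R w"] that by auto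
    also have "\<dots> \<le> d * norm v + d * norm w"
      using that by (intro add_mono mult_right_mono) auto
    also have "\<dots> < d * (norm v + norm w + 1)" using d by (simp add: algebra_simps)
    also have "\<dots> = e"
      unfolding d_def using add_nonneg_pos[of "norm v + norm w" 1] by simp
    finally have "dist x (x + s *\<^sub>R v + t *\<^sub>R w) < e"
      by (simp add: dist_norm norm_minus_commute algebra_simps)
    then show ?thesis using e(2) by auto
  qed
  define h where "h n = d / (2 + real n)" for n
  have h: "0 < h n" "h n < d" for n
    using d by (auto simp: h_def divide_simps algebra_simps add_pos_nonneg)
  have h0: "h \<longlonglongrightarrow> 0"
    unfolding h_def by real_asymp
  have "\<exists>s t s' t'. s \<in> {0..h n} \<and> t \<in> {0..h n} \<and> s' \<in> {0..h n} \<and> t' \<in> {0..h n} \<and>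
      G (x + s *\<^sub>R v + t *\<^sub>R w) w = H (x + s' *\<^sub>R v + t' *\<^sub>R w) v" for n
  proof -
    have m: "x + s *\<^sub>R v + t *\<^sub>R w \<in> S" "x + t *\<^sub>R w + s *\<^sub>R v \<in> S"
      if "s \<in> {0..h n}" "t \<in> {0..h n}" for s t
      using inS[of s t] that h(2)[of n] by (auto simp: add.commute add.left_commute)
    obtain s t where st: "s \<in> {0..h n}" "t \<in> {0..h n}"
      "f (x + h n *\<^sub>R v + h n *\<^sub>R w) - f (x + h n *\<^sub>R v) - f (x + h n *\<^sub>R w) + f x =
       h n * h n * G (x + s *\<^sub>R v + t *\<^sub>R w) w"
      using second_difference[OF f Fv h(1) m(1)] by blast
    obtain s' t' where st': "s' \<in> {0..h n}" "t' \<in> {0..h n}"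
      "f (x + h n *\<^sub>R w + h n *\<^sub>R v) - f (x + h n *\<^sub>R w) - f (x + h n *\<^sub>R v) + f x =
       h n * h n * H (x + s' *\<^sub>R w + t' *\<^sub>R v) v"
      using second_difference[OF f Fw h(1) m(2)] by blast
    have "h n * h n * G (x + s *\<^sub>R v + t *\<^sub>R w) w = h n * h n * H (x + t' *\<^sub>R v + s' *\<^sub>R w) v"
      using st(3) st'(3) by (simp add: algebra_simps)
    then have "G (x + s *\<^sub>R v + t *\<^sub>R w) w = H (x + t' *\<^sub>R v + s' *\<^sub>R w) v"
      using h(1)[of n] by simp
    then show ?thesis using st st' by blast
  qed
  then obtain s t s' t' where
    st: "\<And>n. s n \<in> {0..h n}" "\<And>n. t n \<in> {0..h n}" "\<And>n. s' n \<in> {0..h n}" "\<And>n. t' n \<in> {0..h n}"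
    and eq: "\<And>n. G (x + s n *\<^sub>R v + t n *\<^sub>R w) w = H (x + s' n *\<^sub>R v + t' n *\<^sub>R w) v"
    by metis
  have lim0: "r \<longlonglongrightarrow> 0" if "\<And>n. r n \<in> {0..h n}" for r
    by (rule tendsto_sandwich[of "\<lambda>_. 0" _ _ h]) (use that h0 in auto)
  have lim: "(\<lambda>n. x + r n *\<^sub>R v + q n *\<^sub>R w) \<longlonglongrightarrow> x"
    if "\<And>n. r n \<in> {0..h n}" "\<And>n. q n \<in> {0..h n}" for r q
    using lim0[of r] lim0[of q] that by (auto intro!: tendsto_eq_intros)
  have c: "(\<lambda>n. K (x + r n *\<^sub>R v + q n *\<^sub>R w)) \<longlonglongrightarrow> K x"
    if "continuous_on S K" "\<And>n. r n \<in> {0..h n}" "\<And>n. q n \<in> {0..h n}" for r q and K :: "'a \<Rightarrow> real"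
    using continuous_on_tendsto_compose[OF that(1) lim[OF that(2,3)] assms(2)]
      inS that(2,3) h by (auto simp: eventually_sequentially intro!: inS) (meson atLeastAtMost_iff le_less_trans)
  show ?thesis
    using c[OF contG st(1,2)] c[OF contH st(3,4)] unfolding eq by (rule LIMSEQ_unique)
qed

lemma smooth_on_symmetric:
  fixes f :: "'a::real_normed_vector \<Rightarrow> real"
  assumes "open S" "x \<in> S" "smooth_on S f"
  shows "frechet_derivative (\<lambda>y. frechet_derivative f (at y) v) (at x) w =
    frechet_derivative (\<lambda>y. frechet_derivative f (at y) w) (at x) v"
  by (rule second_derivative_symmetric[OF assms(1,2), where f=f])
    (auto intro!: smooth_on_has_derivative[of S] smooth_on_deriv assms smooth_on_imp_continuous_on)

text \<open>The Poincare lemma for 1-forms: integrate \<open>\<beta>\<close> along the segments issuing from \<open>a\<close>.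
  Differentiating under the integral sign produces, after one use of closedness, the integrand
  \<open>\<delta> x t = t \<beta>'(\<gamma>) (x - a) + \<beta> (\<gamma>)\<close>, which is the derivative of \<open>t \<beta> (\<gamma>)\<close> with
  respect to \<open>t\<close>; its integral over \<open>[0, 1]\<close> is therefore \<open>\<beta> x\<close>.\<close>

lemma poincare_convex:
  fixes \<beta> :: "'e::euclidean_space \<Rightarrow> 'e \<Rightarrow>\<^sub>L real"
  assumes "open S" "convex S" "a \<in> S"
    and der: "\<And>x. x \<in> S \<Longrightarrow> (\<beta> has_derivative \<beta>' x) (at x)"
    and cont: "\<And>v. continuous_on S (\<lambda>x. \<beta>' x v)"
    and closed: "\<And>x v w. x \<in> S \<Longrightarrow> blinfun_apply (\<beta>' x v) w = blinfun_apply (\<beta>' x w) v"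
  obtains u where "\<And>x. x \<in> S \<Longrightarrow> (u has_derivative blinfun_apply (\<beta> x)) (at x)"
proof -
  define \<gamma> where "\<gamma> x t = a + t *\<^sub>R (x - a)" for x and t :: real
  define u where "u x = integral (cbox 0 1) (\<lambda>t. blinfun_apply (\<beta> (\<gamma> x t)) (x - a))" for x
  define \<delta> where "\<delta> x t = t *\<^sub>R \<beta>' (\<gamma> x t) (x - a) + \<beta> (\<gamma> x t)" for x t
  have \<gamma>S: "\<gamma> x t \<in> S" if "x \<in> S" "t \<in> cbox 0 1" for x t
  proof -
    have "\<gamma> x t = (1 - t) *\<^sub>R a + t *\<^sub>R x" by (simp add: \<gamma>_def algebra_simps)
    then show ?thesis using that assms(2,3) by (auto simp: convex_alt)
  qed
  have contb: "continuous_on S \<beta>"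
    using der has_derivative_continuous continuous_at_imp_continuous_on by blast
  have lin: "linear (\<beta>' x)" if "x \<in> S" for x
    using der[OF that] has_derivative_linear by blast
  have d1: "((\<lambda>x. blinfun_apply (\<beta> (\<gamma> x t)) (x - a)) has_derivative blinfun_apply (\<delta> x t)) (at x within S)"
    if "x \<in> S" "t \<in> cbox 0 1" for x t
  proof -
    have "((\<lambda>x. \<gamma> x t) has_derivative (\<lambda>v. t *\<^sub>R v)) (at x within S)"
      unfolding \<gamma>_def by (auto intro!: derivative_eq_intros)
    from has_derivative_compose[OF this der[OF \<gamma>S[OF that]]]
    have 1: "((\<lambda>x. \<beta> (\<gamma> x t)) has_derivative (\<lambda>v. \<beta>' (\<gamma> x t) (t *\<^sub>R v))) (at x within S)" .
    have 2: "((\<lambda>x. x - a) has_derivative (\<lambda>v. v)) (at x within S)"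
      by (auto intro!: derivative_eq_intros)
    show ?thesis
      by (rule has_derivative_eq_rhs[OF bounded_bilinear.FDERIV[OF bounded_bilinear_blinfun_apply 1 2]])
        (simp add: \<delta>_def fun_eq_iff linear_cmul[OF lin[OF \<gamma>S[OF that]]] blinfun.add_left
          blinfun.scaleR_left closed[OF \<gamma>S[OF that], of "x - a"])
  qed
  have c\<gamma>: "continuous_on (S \<times> cbox 0 1) (\<lambda>(x,t). \<gamma> x t)"
    unfolding \<gamma>_def split_beta by (intro continuous_intros)
  have cc: "continuous_on (S \<times> cbox 0 1) (\<lambda>(x,t). K (\<gamma> x t))" if "continuous_on S K" for K :: "'e \<Rightarrow> 'e \<Rightarrow>\<^sub>L real"
  proof -
    have "(\<lambda>(x,t). \<gamma> x t) ` (S \<times> cbox 0 1) \<subseteq> S" using \<gamma>S by auto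
    from continuous_on_compose2[OF that c\<gamma> this] show ?thesis by (simp add: split_beta)
  qed
  \<comment> \<open>Only the directional derivatives \<open>\<beta>' x v\<close> with \<open>v\<close> fixed are known to be continuous; joint
    continuity in \<open>x\<close> and \<open>v\<close> follows by expanding \<open>v\<close> in a basis.\<close>
  have expand: "\<beta>' y v = (\<Sum>b\<in>Basis. (v \<bullet> b) *\<^sub>R \<beta>' y b)" if "y \<in> S" for y v
    using linear_sum[OF lin[OF that], of "\<lambda>b. (v \<bullet> b) *\<^sub>R b" Basis]
    by (simp add: euclidean_representation linear_cmul[OF lin[OF that]])
  have c\<delta>: "continuous_on (S \<times> cbox 0 1) (\<lambda>(x,t). \<delta> x t)"
  proof -
    have "continuous_on (S \<times> cbox 0 1)
       (\<lambda>z. snd z *\<^sub>R (\<Sum>b\<in>Basis. ((fst z - a) \<bullet> b) *\<^sub>R \<beta>' (\<gamma> (fst z) (snd z)) b) + \<beta> (\<gamma> (fst z) (snd z)))"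
      using cc[OF cont] cc[OF contb] unfolding split_beta by (intro continuous_intros) auto
    then show ?thesis
      by (rule continuous_on_eq) (auto simp: \<delta>_def expand[OF \<gamma>S])
  qed
  have i\<delta>: "(\<delta> x has_integral \<beta> x) (cbox 0 1)" if "x \<in> S" for x
  proof -
    have "((\<lambda>t. t *\<^sub>R \<beta> (\<gamma> x t)) has_vector_derivative \<delta> x t) (at t within {0..1})"
      if "t \<in> {0..1}" for t
    proof -
      have t: "t \<in> cbox 0 1" using that by auto
      have "((\<lambda>t. \<gamma> x t) has_derivative (\<lambda>r. r *\<^sub>R (x - a))) (at t within {0..1})"
        unfolding \<gamma>_def by (auto intro!: derivative_eq_intros)
      from has_derivative_compose[OF this der[OF \<gamma>S[OF \<open>x \<in> S\<close> t]]]
      have 1: "((\<lambda>t. \<beta> (\<gamma> x t)) has_derivative (\<lambda>r. \<beta>' (\<gamma> x t) (r *\<^sub>R (x - a)))) (at t within {0..1})" .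
      show ?thesis
        unfolding has_vector_derivative_def
        by (rule has_derivative_eq_rhs[OF has_derivative_scaleR[OF has_derivative_ident 1]])
          (simp add: \<delta>_def linear_cmul[OF lin[OF \<gamma>S[OF \<open>x \<in> S\<close> t]]] scaleR_add_right
            mult.commute add.commute)
    qed
    from fundamental_theorem_of_calculus[OF _ this]
    show ?thesis by (simp add: \<gamma>_def)
  qed
  have "(u has_derivative blinfun_apply (\<beta> x)) (at x)" if "x \<in> S" for x
  proof -
    have "(\<lambda>t. blinfun_apply (\<beta> (\<gamma> y t)) (y - a)) integrable_on cbox 0 1" if "y \<in> S" for y
    proof (rule integrable_continuous)
      have "continuous_on (cbox 0 1) (\<lambda>t. \<beta> (\<gamma> y t))"
        by (rule continuous_on_compose2[OF contb]) (auto simp: \<gamma>S[OF that, simplified] \<gamma>_def intro!: continuous_intros \<gamma>S[OF that, unfolded \<gamma>_def])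
      then show "continuous_on (cbox 0 1) (\<lambda>t. blinfun_apply (\<beta> (\<gamma> y t)) (y - a))"
        by (intro continuous_intros)
    qed
    from leibniz_rule[OF d1 this c\<delta> that assms(2)]
    show ?thesis
      unfolding u_def using integral_unique[OF i\<delta>[OF that]] at_within_open[OF that assms(1)] by simp
  qed
  then show thesis using that by blast
qed

section \<open>Linear algebra of a paracontact tangent space\<close>

lemma common_zero_of_three_functionals:
  fixes f g h :: "'e::euclidean_space \<Rightarrow> real"
  assumes "linear f" "linear g" "linear h" "3 < DIM('e)"
  obtains y where "y \<noteq> 0" "f y = 0" "g y = 0" "h y = 0"
proof -
  define T where "T = {adjoint f 1, adjoint g 1, adjoint h 1}"
  have "card T \<le> 3"
    unfolding T_def by (auto simp: card_insert_if)
  moreover have "dim T \<le> card T" by (rule dim_le_card) (auto simp: T_def span_base)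
  ultimately have "dim T < DIM('e)" using assms(4) by linarith
  then obtain y where y: "y \<noteq> 0" "\<And>t. t \<in> span T \<Longrightarrow> orthogonal y t"
    using orthogonal_to_subspace_exists by blast
  have "k y = 0" if "linear k" "adjoint k 1 \<in> T" for k :: "'e \<Rightarrow> real"
    using y(2)[OF span_base[OF that(2)]] adjoint_works[OF that(1), of y 1]
    by (simp add: orthogonal_def)
  then show thesis using that[of y] y(1) assms(1-3) by (auto simp: T_def)
qed

text \<open>Wedging with a 2-form \<open>\<Phi>\<close> of large rank is injective on 1-forms. If \<open>\<beta> x \<noteq> 0\<close>, the
  equation \<open>\<beta> \<and> \<Phi> = 0\<close> expresses \<open>\<Phi>\<close> by \<open>\<beta>\<close> and \<open>\<Phi> x\<close>, so every common zero of these
  two functionals is in the kernel of \<open>\<Phi>\<close>. Together with \<open>\<eta>\<close>, which detects that kernel, these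
  are three functionals, and in dimension at least 4 they have a common zero \<open>y \<noteq> 0\<close>. This is
  where \<open>n \<ge> 2\<close> enters: for \<open>n = 1\<close> the dimension is 3.\<close>

lemma wedge_eq_zero_imp_zero:
  fixes \<beta> \<eta> :: "'e::euclidean_space \<Rightarrow> real" and \<Phi> :: "'e \<Rightarrow> 'e \<Rightarrow> real"
  assumes "linear \<beta>" "linear \<eta>" "\<And>x. linear (\<Phi> x)" "3 < DIM('e)"
    and nondeg: "\<And>y. \<eta> y = 0 \<Longrightarrow> (\<And>z. \<Phi> y z = 0) \<Longrightarrow> y = 0"
    and wedge: "\<And>x y z. \<beta> x * \<Phi> y z + \<beta> y * \<Phi> z x + \<beta> z * \<Phi> x y = 0"
  shows "\<beta> x = 0"
proof (rule ccontr)
  assume x: "\<beta> x \<noteq> 0"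
  obtain y where y: "y \<noteq> 0" "\<beta> y = 0" "\<Phi> x y = 0" "\<eta> y = 0"
    using common_zero_of_three_functionals[OF assms(1) assms(3)[of x] assms(2,4)] by blast
  have "\<Phi> y z = 0" for z
    using wedge[of x y z] x y by simp
  with nondeg y(1,4) show False by blast
qed

text \<open>Nondegeneracy of \<open>g\<close> is what a given signature provides. The fundamental form is
  \<open>(v, w) \<mapsto> g (\<phi> v) w\<close>.\<close>

locale paracontact_metric_vector_space =
  fixes \<phi> :: "'e::euclidean_space \<Rightarrow>\<^sub>L 'e" and \<xi> :: 'e and \<eta> :: "'e \<Rightarrow>\<^sub>L real"
    and g :: "'e \<Rightarrow>\<^sub>L 'e \<Rightarrow>\<^sub>L real"
  assumes eta_xi: "\<eta> \<xi> = 1"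
    and phi_phi: "\<phi> (\<phi> v) = v - \<eta> v *\<^sub>R \<xi>"
    and sym: "g v w = g w v"
    and nondegenerate: "(\<And>w. g v w = 0) \<Longrightarrow> v = 0"
    and compatible: "g (\<phi> v) (\<phi> w) = - g v w + \<eta> v * \<eta> w"
begin

lemma phi_xi: "\<phi> \<xi> = 0"
proof -
  have "\<phi> (\<phi> \<xi>) = 0" using phi_phi[of \<xi>] eta_xi by simp
  then have 1: "\<phi> \<xi> = \<eta> (\<phi> \<xi>) *\<^sub>R \<xi>" using phi_phi[of "\<phi> \<xi>"] by (simp add: blinfun.zero_right)
  then have "\<phi> (\<phi> \<xi>) = \<eta> (\<phi> \<xi>) *\<^sub>R \<phi> \<xi>" by (metis blinfun.scaleR_right)
  with \<open>\<phi> (\<phi> \<xi>) = 0\<close> have "\<eta> (\<phi> \<xi>) = 0 \<or> \<phi> \<xi> = 0" by simp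
  then show ?thesis using 1 by auto
qed

lemma g_xi: "g \<xi> v = \<eta> v"
  using compatible[of \<xi> v] eta_xi by (simp add: phi_xi blinfun.zero_right blinfun.zero_left)

lemma eta_phi: "\<eta> (\<phi> v) = 0"
proof -
  have "\<phi> (\<phi> (\<phi> v)) = \<phi> v"
    using phi_phi[of v] by (simp add: blinfun.diff_right blinfun.scaleR_right phi_xi)
  then have "\<eta> (\<phi> v) *\<^sub>R \<xi> = 0" using phi_phi[of "\<phi> v"] by simp
  moreover have "\<xi> \<noteq> 0" using eta_xi by (auto simp: blinfun.zero_right)
  ultimately show ?thesis by simp
qed

lemma fundamental_antisym: "g (\<phi> v) w = - g (\<phi> w) v"
proof -
  have w: "w = \<phi> (\<phi> w) + \<eta> w *\<^sub>R \<xi>" using phi_phi[of w] by simp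
  have "g (\<phi> v) w = g (\<phi> v) (\<phi> (\<phi> w)) + \<eta> w * g (\<phi> v) \<xi>"
    by (subst w) (simp add: blinfun.add_right blinfun.scaleR_right)
  then show ?thesis
    using compatible[of v "\<phi> w"] sym[of v "\<phi> w"] sym[of "\<phi> v" \<xi>] by (simp add: g_xi eta_phi)
qed

lemma fundamental_xi: "g (\<phi> \<xi>) v = 0" "g (\<phi> v) \<xi> = 0"
  using fundamental_antisym[of v \<xi>] by (simp_all add: phi_xi blinfun.zero_left blinfun.zero_right)

lemma fundamental_nondegenerate:
  assumes "\<eta> v = 0" "\<And>w. g (\<phi> v) w = 0"
  shows "v = 0"
  using nondegenerate[OF assms(2)] phi_phi[of v] assms(1) by (simp add: blinfun.zero_right)

lemma wedge_fundamental_eq_zero: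
  assumes "linear \<beta>" "3 < DIM('e)"
    and "\<And>x y z. \<beta> x * g (\<phi> y) z + \<beta> y * g (\<phi> z) x + \<beta> z * g (\<phi> x) y = 0"
  shows "\<beta> x = 0"
proof (rule wedge_eq_zero_imp_zero[OF assms(1) _ _ assms(2)])
  show "linear \<eta>" "linear (blinfun_apply (g (\<phi> x)))" for x
    by (auto intro: bounded_linear.linear blinfun.bounded_linear_right)
  show "y = 0" if "\<eta> y = 0" "\<And>z. g (\<phi> y) z = 0" for y
    by (rule fundamental_nondegenerate[OF that])
qed (rule assms(3))

end

lemma has_signature_nondegenerate:
  assumes "has_signature B r s" "\<And>v w. blinfun_apply (B v) w = blinfun_apply (B w) v"
    "\<And>w. blinfun_apply (B v) w = 0"
  shows "v = 0"
proof -
  obtain P N where PN: "subspace P" "subspace N" "span (P \<union> N) = UNIV"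
    "\<forall>v\<in>P. v \<noteq> 0 \<longrightarrow> B v v > 0" "\<forall>w\<in>N. w \<noteq> 0 \<longrightarrow> B w w < 0" "\<forall>v\<in>P. \<forall>w\<in>N. B v w = 0"
    using assms(1) unfolding has_signature_def by metis
  have "v \<in> span (P \<union> N)" using PN(3) by simp
  then obtain a b where ab: "a \<in> P" "b \<in> N" "v = a + b"
    unfolding span_Un span_eq_iff[THEN iffD2, OF PN(1)] span_eq_iff[THEN iffD2, OF PN(2)] by auto
  have "B v a = B a a" "B v b = B b b"
    using PN(6) ab assms(2)[of b a] by (simp_all add: blinfun.add_left blinfun.add_right)
  then have "B a a = 0" "B b b = 0" using assms(3) by simp_all
  then have "a = 0" "b = 0" using PN(4,5) ab by force+
  then show ?thesis using ab by simp
qed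

section \<open>The integrability condition in a chart\<close>

text \<open>Apply the exterior derivative to \<open>d\<Phi> = 2 \<alpha> \<eta> \<and> \<Phi>\<close>. The left side vanishes because second
  derivatives commute; on the right \<open>d\<eta> = 0\<close> and \<open>\<eta> \<and> d\<Phi> = 2 \<alpha> \<eta> \<and> \<eta> \<and> \<Phi> = 0\<close>,
  so that only \<open>2 d\<alpha> \<and> \<eta> \<and> \<Phi> = 0\<close> remains. The 4-form is written out as the alternating sum
  over the argument fed to \<open>d\<alpha>\<close>, with \<open>T = \<eta> \<and> \<Phi>\<close>.\<close>

lemma d_alpha_wedge_eta_wedge_fundamental:
  fixes \<Phi> :: "'e::euclidean_space \<Rightarrow> 'e \<Rightarrow>\<^sub>L 'e \<Rightarrow>\<^sub>L real"
    and \<alpha> :: "'e \<Rightarrow> real"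
  assumes "open S" "smooth_on S \<eta>" "smooth_on S \<Phi>" "smooth_on S \<alpha>" "p \<in> S"
    and anti: "\<And>q v w. q \<in> S \<Longrightarrow> \<Phi> q v w = - \<Phi> q w v"
    and closed: "\<And>q v w. q \<in> S \<Longrightarrow>
      blinfun_apply (frechet_derivative \<eta> (at q) v) w = blinfun_apply (frechet_derivative \<eta> (at q) w) v"
    and d\<Phi>: "\<And>q x y z. q \<in> S \<Longrightarrow>
      blinfun_apply (blinfun_apply (frechet_derivative \<Phi> (at q) x) y) z +
      blinfun_apply (blinfun_apply (frechet_derivative \<Phi> (at q) y) z) x +
      blinfun_apply (blinfun_apply (frechet_derivative \<Phi> (at q) z) x) y =
      2 * \<alpha> q * (\<eta> q x * \<Phi> q y z + \<eta> q y * \<Phi> q z x + \<eta> q z * \<Phi> q x y)"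
  defines "T \<equiv> \<lambda>x y z. \<eta> p x * \<Phi> p y z + \<eta> p y * \<Phi> p z x + \<eta> p z * \<Phi> p x y"
    and "d\<alpha> \<equiv> frechet_derivative \<alpha> (at p)"
  shows "d\<alpha> w * T x y z - d\<alpha> x * T w y z + d\<alpha> y * T w x z - d\<alpha> z * T w x y = 0"
proof -
  define D where "D f v q = frechet_derivative f (at q) v" for f :: "'e \<Rightarrow> real" and v q
  define E where "E v q = blinfun_apply (\<eta> q) v" for v q
  define F where "F v w q = blinfun_apply (blinfun_apply (\<Phi> q) v) w" for v w q
  have sE: "smooth_on S (E v)" and sF: "smooth_on S (F v w)" for v w
    unfolding E_def F_def by (intro smooth_on_blinfun_apply assms(1-3))+
  have DE: "D (E w) v q = blinfun_apply (frechet_derivative \<eta> (at q) v) w" if "q \<in> S" for v w q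
    unfolding D_def E_def by (rule frechet_derivative_blinfun_apply[OF assms(2) that])
  have DF: "D (F y z) x q = blinfun_apply (blinfun_apply (frechet_derivative \<Phi> (at q) x) y) z"
    if "q \<in> S" for x y z q
    unfolding D_def F_def
    using frechet_derivative_blinfun_apply[OF smooth_on_blinfun_apply[OF assms(1,3)] that]
      frechet_derivative_blinfun_apply[OF assms(3) that] by simp
  have hd: "(f has_derivative (\<lambda>v. D f v q)) (at q)" if "smooth_on S f" "q \<in> S" for f q
    using smooth_on_has_derivative[OF that] unfolding D_def .
  have sD: "smooth_on S (\<lambda>q. D f v q)" if "smooth_on S f" for f v
    unfolding D_def by (rule smooth_on_deriv[OF that])
  have eq: "D (F y z) x q + D (F z x) y q + D (F x y) z q =
      2 * \<alpha> q * (E x q * F y z q + E y q * F z x q + E z q * F x y q)" if "q \<in> S" for x y z q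
    using d\<Phi>[OF that, of x y z] by (simp add: DF[OF that] E_def F_def)
  have Fq: "F v w q = - F w v q" if "q \<in> S" for v w q
    unfolding F_def by (rule anti[OF that])
  have Fanti: "D (\<lambda>q. D (F v w) a q) b p = - D (\<lambda>q. D (F w v) a q) b p"
    and Fanti1: "D (F v w) a p = - D (F w v) a p" for v w a b
  proof -
    have e1: "D (F v w) a q = - D (F w v) a q" if "q \<in> S" for q
    proof -
      have "((\<lambda>q. - F w v q) has_derivative (\<lambda>a. - D (F w v) a q)) (at q)"
        by (rule has_derivative_minus[OF hd[OF sF that]])
      then have "(F v w has_derivative (\<lambda>a. - D (F w v) a q)) (at q)"
        by (rule has_derivative_transform_within_open[OF _ assms(1) that]) (rule Fq[symmetric])
      from fun_cong[OF frechet_derivative_at[OF this], of a] show ?thesis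
        unfolding D_def[of "F v w"] by (rule sym)
    qed
    then show "D (F v w) a p = - D (F w v) a p" using assms(5) .
    have "((\<lambda>q. - D (F w v) a q) has_derivative (\<lambda>b. - D (\<lambda>q. D (F w v) a q) b p)) (at p)"
      by (rule has_derivative_minus[OF hd[OF sD[OF sF] assms(5)]])
    then have "((\<lambda>q. D (F v w) a q) has_derivative (\<lambda>b. - D (\<lambda>q. D (F w v) a q) b p)) (at p)"
      by (rule has_derivative_transform_within_open[OF _ assms(1,5)]) (rule e1[symmetric])
    from fun_cong[OF frechet_derivative_at[OF this], of b] show "D (\<lambda>q. D (F v w) a q) b p = - D (\<lambda>q. D (F w v) a q) b p"
      unfolding D_def[of "\<lambda>q. D (F v w) a q"] by (rule sym)
  qed
  have Fsym: "D (\<lambda>q. D (F v w) a q) b p = D (\<lambda>q. D (F v w) b q) a p" for v w a b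
    unfolding D_def by (rule smooth_on_symmetric[OF assms(1,5) sF])
  have Esym: "D (E v) w p = D (E w) v p" for v w
    using closed[OF assms(5)] by (simp add: DE[OF assms(5)])
  note Fp = Fq[OF assms(5)]
  have deq: "D (\<lambda>q. D (F y z) x q) w p + D (\<lambda>q. D (F z x) y q) w p + D (\<lambda>q. D (F x y) z q) w p =
      2 * D \<alpha> w p * (E x p * F y z p + E y p * F z x p + E z p * F x y p) +
      2 * \<alpha> p * (D (E x) w p * F y z p + E x p * D (F y z) w p +
                 D (E y) w p * F z x p + E y p * D (F z x) w p +
                 D (E z) w p * F x y p + E z p * D (F x y) w p)" for w x y z
  proof -
    have "((\<lambda>q. D (F y z) x q + D (F z x) y q + D (F x y) z q) has_derivative
       (\<lambda>w. D (\<lambda>q. D (F y z) x q) w p + D (\<lambda>q. D (F z x) y q) w p + D (\<lambda>q. D (F x y) z q) w p)) (at p)"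
      by (intro has_derivative_add hd[OF sD[OF sF] assms(5)])
    then have l: "((\<lambda>q. 2 * \<alpha> q * (E x q * F y z q + E y q * F z x q + E z q * F x y q)) has_derivative
       (\<lambda>w. D (\<lambda>q. D (F y z) x q) w p + D (\<lambda>q. D (F z x) y q) w p + D (\<lambda>q. D (F x y) z q) w p)) (at p)"
      by (rule has_derivative_transform_within_open[OF _ assms(1,5) eq])
    have r: "((\<lambda>q. 2 * \<alpha> q * (E x q * F y z q + E y q * F z x q + E z q * F x y q)) has_derivative
       (\<lambda>w. 2 * D \<alpha> w p * (E x p * F y z p + E y p * F z x p + E z p * F x y p) +
      2 * \<alpha> p * (D (E x) w p * F y z p + E x p * D (F y z) w p +
                 D (E y) w p * F z x p + E y p * D (F z x) w p +
                 D (E z) w p * F x y p + E z p * D (F x y) w p))) (at p)"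
      by (auto intro!: derivative_eq_intros hd[OF assms(4,5)] hd[OF sE assms(5)] hd[OF sF assms(5)]
          simp: algebra_simps)
    show ?thesis using fun_cong[OF has_derivative_unique[OF l r], of w] .
  qed
  \<comment> \<open>\<open>A w\<close> is the derivative of \<open>d\<Phi>\<close> in the direction \<open>w\<close>; its alternation is \<open>d (d\<Phi>)\<close>.\<close>
  define A where "A w x y z = D (\<lambda>q. D (F y z) x q) w p + D (\<lambda>q. D (F z x) y q) w p + D (\<lambda>q. D (F x y) z q) w p" for w x y z
  have ddF: "A w x y z - A x w y z + A y w x z - A z w x y = 0"
    using Fsym[of y z x w] Fsym[of x y z w] Fsym[of z w y x] Fsym[of w x z y]
      Fanti[of z x y w] Fsym[of x z y w] Fanti[of w y z x] Fsym[of y w z x]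
    unfolding A_def by linarith
  \<comment> \<open>\<open>B w\<close> is the derivative of \<open>\<eta> \<and> \<Phi>\<close> in the direction \<open>w\<close>, \<open>C\<close> is \<open>d\<Phi>\<close> and \<open>T'\<close> is
    \<open>\<eta> \<and> \<Phi>\<close>. The alternation of \<open>B\<close> is \<open>d\<eta> \<and> \<Phi> - \<eta> \<and> d\<Phi>\<close>.\<close>
  define B where "B w x y z = D (E x) w p * F y z p + E x p * D (F y z) w p +
                 D (E y) w p * F z x p + E y p * D (F z x) w p +
                 D (E z) w p * F x y p + E z p * D (F x y) w p" for w x y z
  define C where "C x y z = D (F y z) x p + D (F z x) y p + D (F x y) z p" for x y z
  define T' where "T' x y z = E x p * F y z p + E y p * F z x p + E z p * F x y p" for x y z
  have "B w x y z - B x w y z + B y w x z - B z w x y =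
    - (E w p * C x y z - E x p * C w y z + E y p * C w x z - E z p * C w x y)"
    unfolding B_def C_def Esym[of x w] Esym[of y w] Esym[of z w] Esym[of y x] Esym[of z x] Esym[of z y]
      Fp[of x w] Fp[of y w] Fp[of z w] Fp[of y x] Fp[of z x] Fp[of z y]
      Fanti1[of x w] Fanti1[of y w] Fanti1[of z w] Fanti1[of y x] Fanti1[of z x] Fanti1[of z y]
    by (simp add: algebra_simps)
  also have "\<dots> = - 2 * \<alpha> p * (E w p * T' x y z - E x p * T' w y z + E y p * T' w x z - E z p * T' w x y)"
    using eq[OF assms(5)] unfolding C_def[symmetric] T'_def[symmetric] by (simp add: algebra_simps)
  also have "E w p * T' x y z - E x p * T' w y z + E y p * T' w x z - E z p * T' w x y = 0"
    unfolding T'_def Fp[of x w] Fp[of y w] Fp[of z w] Fp[of y x] Fp[of z x] Fp[of z y]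
    by (simp add: algebra_simps)
  finally have B: "B w x y z - B x w y z + B y w x z - B z w x y = 0" by simp
  have A: "A w x y z = 2 * D \<alpha> w p * T' x y z + 2 * \<alpha> p * B w x y z" for w x y z
    unfolding A_def B_def T'_def by (rule deq)
  have "0 = 2 * (D \<alpha> w p * T' x y z - D \<alpha> x p * T' w y z + D \<alpha> y p * T' w x z - D \<alpha> z p * T' w x y)
     + 2 * \<alpha> p * (B w x y z - B x w y z + B y w x z - B z w x y)"
    using ddF unfolding A by (simp add: algebra_simps)
  then have "D \<alpha> w p * T' x y z - D \<alpha> x p * T' w y z + D \<alpha> y p * T' w x z - D \<alpha> z p * T' w x y = 0"
    unfolding B by simp
  then show ?thesis unfolding T_def T'_def d\<alpha>_def D_def E_def F_def .
qed

section \<open>Fields on a manifold\<close>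

locale smooth_manifold =
  fixes A :: "('m::{t2_space,second_countable_topology}, 'e::euclidean_space) chart set"
  assumes atlas: "smooth_atlas A"
begin

lemma chart_homeomorphism:
  "c \<in> A \<Longrightarrow> homeomorphism (chart_dom c) (chart_map c ` chart_dom c) (chart_map c) (chart_inv c)"
  and open_chart_dom: "c \<in> A \<Longrightarrow> open (chart_dom c)"
  and open_chart_range: "c \<in> A \<Longrightarrow> open (chart_map c ` chart_dom c)"
  using atlas unfolding smooth_atlas_def by blast+

lemma chart_inv_chart_map: "c \<in> A \<Longrightarrow> p \<in> chart_dom c \<Longrightarrow> chart_inv c (chart_map c p) = p"
  using chart_homeomorphism homeomorphism_apply1 by blast

lemma open_chart_image:
  assumes "c \<in> A" "open U"
  shows "open (chart_map c ` (U \<inter> chart_dom c))"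
proof -
  have "openin (top_of_set (chart_dom c)) (U \<inter> chart_dom c)"
    using assms(2) by (metis inf_commute openin_open_Int)
  from homeomorphism_imp_open_map[OF chart_homeomorphism[OF assms(1)] this]
  show ?thesis using open_chart_range[OF assms(1)] openin_open_trans by blast
qed

lemma obtain_chart: obtains c where "c \<in> A" "p \<in> chart_dom c"
  using atlas unfolding smooth_atlas_def by blast

lemma smooth_components_chart:
  "smooth_components A U T \<Longrightarrow> c \<in> A \<Longrightarrow>
    smooth_on (chart_map c ` (U \<inter> chart_dom c)) (\<lambda>x. T c (chart_inv c x))"
  unfolding smooth_components_def by blast

lemma smooth_components_subset:
  "smooth_components A U T \<Longrightarrow> V \<subseteq> U \<Longrightarrow> smooth_components A V T"
  unfolding smooth_components_def by (meson Int_mono image_mono order_refl smooth_on_subset)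

lemma smooth_components_bilinear:
  assumes "bounded_bilinear B" "open U" "smooth_components A U T" "smooth_components A U R"
  shows "smooth_components A U (\<lambda>c p. B (T c p) (R c p))"
  unfolding smooth_components_def
proof
  fix c assume c: "c \<in> A"
  show "smooth_on (chart_map c ` (U \<inter> chart_dom c)) (\<lambda>x. B (T c (chart_inv c x)) (R c (chart_inv c x)))"
    by (rule bounded_bilinear.smooth_on[OF assms(1) open_chart_image[OF c assms(2)]
          smooth_components_chart[OF assms(3) c] smooth_components_chart[OF assms(4) c]])
qed

lemma smooth_components_scaleR:
  "open U \<Longrightarrow> smooth_function A U f \<Longrightarrow> smooth_components A U T \<Longrightarrow>
    smooth_components A U (\<lambda>c p. f p *\<^sub>R T c p)"
  using smooth_components_bilinear[OF bounded_bilinear_scaleR] unfolding smooth_function_def by blast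

lemma smooth_function_exp:
  assumes "open U" "smooth_function A U u"
  shows "smooth_function A U (\<lambda>p. exp (k * u p))"
proof -
  have "smooth_components A U (\<lambda>c p. k * u p)"
    using smooth_components_bilinear[OF bounded_bilinear_mult assms(1), of "\<lambda>_ _. k" "\<lambda>_. u"]
      assms(2) by (simp add: smooth_function_def smooth_components_def smooth_on_const)
  then show ?thesis
    using smooth_on_exp open_chart_image[OF _ assms(1)]
    unfolding smooth_function_def smooth_components_def by blast
qed

lemma smooth_components_has_derivative:
  assumes "smooth_components A U T" "c \<in> A" "q \<in> U" "q \<in> chart_dom c"
  shows "((\<lambda>x. T c (chart_inv c x)) has_derivative coord_deriv c T q) (at (chart_map c q))"
  using smooth_on_has_derivative[OF smooth_components_chart[OF assms(1,2)], of "chart_map c q"] assms(3,4)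
  unfolding coord_deriv_def[abs_def] by blast

lemma smooth_function_has_derivative:
  assumes "smooth_function A U u" "c \<in> A" "q \<in> U" "q \<in> chart_dom c"
  shows "((\<lambda>x. u (chart_inv c x)) has_derivative differential u c q) (at (chart_map c q))"
  using smooth_components_has_derivative[of U "\<lambda>_. u"] assms
  unfolding smooth_function_def differential_def[abs_def] by blast

lemma differential_eqI:
  assumes "((\<lambda>x. u (chart_inv c x)) has_derivative D) (at (chart_map c q))"
  shows "differential u c q v = D v"
  unfolding differential_def coord_deriv_def using frechet_derivative_at[OF assms] by simp

lemma coord_deriv_eqI:
  assumes "((\<lambda>x. T c (chart_inv c x)) has_derivative D) (at (chart_map c q))"
  shows "coord_deriv c T q v = D v"
  unfolding coord_deriv_def using frechet_derivative_at[OF assms] by simp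

lemma differential_exp:
  assumes "smooth_function A U u" "c \<in> A" "q \<in> U" "q \<in> chart_dom c"
  shows "differential (\<lambda>p. exp (k * u p)) c q v = k * exp (k * u q) * differential u c q v"
proof -
  have "((\<lambda>x. exp (k * u (chart_inv c x))) has_derivative
      (\<lambda>v. k * exp (k * u q) * differential u c q v)) (at (chart_map c q))"
    using smooth_function_has_derivative[OF assms]
    by (auto intro!: derivative_eq_intros simp: chart_inv_chart_map assms(2,4))
  then show ?thesis by (rule differential_eqI)
qed

lemma coord_deriv_scaleR:
  assumes "smooth_function A U f" "smooth_components A U T" "c \<in> A" "q \<in> U" "q \<in> chart_dom c"
  shows "coord_deriv c (\<lambda>c p. f p *\<^sub>R T c p) q v =
    f q *\<^sub>R coord_deriv c T q v + differential f c q v *\<^sub>R T c q"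
proof -
  have "((\<lambda>x. f (chart_inv c x) *\<^sub>R T c (chart_inv c x)) has_derivative
     (\<lambda>v. f q *\<^sub>R coord_deriv c T q v + differential f c q v *\<^sub>R T c q)) (at (chart_map c q))"
    using has_derivative_scaleR[OF smooth_function_has_derivative[OF assms(1,3-5)]
        smooth_components_has_derivative[OF assms(2-5)]]
    by (simp add: chart_inv_chart_map assms(3,5))
  then show ?thesis by (rule coord_deriv_eqI)
qed

lemma transition_has_derivative:
  assumes "c \<in> A" "c' \<in> A" "q \<in> chart_dom c" "q \<in> chart_dom c'"
  shows "((\<lambda>x. chart_map c' (chart_inv c x)) has_derivative transition_deriv c c' q) (at (chart_map c q))"
proof -
  have "smooth_on (chart_map c ` (chart_dom c \<inter> chart_dom c')) (chart_map c' \<circ> chart_inv c)"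
    using atlas assms(1,2) unfolding smooth_atlas_def by blast
  then have "((chart_map c' \<circ> chart_inv c) has_derivative transition_deriv c c' q) (at (chart_map c q))"
    unfolding transition_deriv_def[abs_def] using assms by (intro smooth_on_has_derivative) auto
  then show ?thesis by (simp add: o_def)
qed

text \<open>On a ball in a chart a function with zero derivative is constant; connectedness of \<open>U\<close>
  then makes the locally constant function constant.\<close>

lemma constant_of_zero_differential:
  assumes "open U" "connected U" "smooth_function A U f"
    and zero: "\<And>c q v. c \<in> A \<Longrightarrow> q \<in> U \<Longrightarrow> q \<in> chart_dom c \<Longrightarrow> differential f c q v = 0"
  shows "f constant_on U"
proof (rule locally_constant_imp_constant[OF assms(2)])
  fix a assume a: "a \<in> U"
  obtain c where c: "c \<in> A" "a \<in> chart_dom c" by (rule obtain_chart)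
  let ?W = "chart_map c ` (U \<inter> chart_dom c)"
  have "open ?W" "chart_map c a \<in> ?W" using open_chart_image[OF c(1) assms(1)] a c(2) by auto
  then obtain r where r: "r > 0" "ball (chart_map c a) r \<subseteq> ?W" using openE by blast
  let ?B = "ball (chart_map c a) r"
  have "((\<lambda>x. f (chart_inv c x)) has_derivative (\<lambda>_. 0)) (at x within ?B)" if x: "x \<in> ?B" for x
  proof -
    obtain q where q: "q \<in> U" "q \<in> chart_dom c" "x = chart_map c q" using r(2) x by blast
    have "differential f c q = (\<lambda>_. 0)" using zero[OF c(1) q(1,2)] by blast
    then show ?thesis
      using smooth_function_has_derivative[OF assms(3) c(1) q(1,2)] q(3)
      by (auto intro: has_derivative_at_withinI)
  qed
  then obtain k where k: "\<And>x. x \<in> ?B \<Longrightarrow> f (chart_inv c x) = k"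
    using has_derivative_zero_constant[of ?B "\<lambda>x. f (chart_inv c x)"] by auto
  let ?T = "(U \<inter> chart_dom c) \<inter> chart_map c -` ?B"
  have "continuous_on (chart_dom c) (chart_map c)"
    using chart_homeomorphism[OF c(1)] homeomorphism_def by blast
  then have "open ?T"
    using open_chart_dom[OF c(1)] assms(1)
    by (intro continuous_open_preimage[OF continuous_on_subset]) auto
  moreover have "f x = k" if "x \<in> ?T" for x
    using k[of "chart_map c x"] that chart_inv_chart_map[OF c(1)] by auto
  moreover have "a \<in> ?T" using a c(2) r(1) by auto
  ultimately show "\<exists>T. openin (top_of_set U) T \<and> a \<in> T \<and> (\<forall>x\<in>T. f x = f a)"
    by (intro exI[of _ ?T]) (auto intro!: open_openin_trans assms(1))
qed

lemma smooth_function_differential_add_const: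
  assumes "open U" "smooth_function A U u" "\<And>q. q \<in> U \<Longrightarrow> w q = u q + k"
  shows "smooth_function A U w"
    and "c \<in> A \<Longrightarrow> q \<in> U \<Longrightarrow> q \<in> chart_dom c \<Longrightarrow> differential w c q v = differential u c q v"
proof -
  have eq: "u (chart_inv c x) + k = w (chart_inv c x)"
    if c: "c \<in> A" and x: "x \<in> chart_map c ` (U \<inter> chart_dom c)" for c x
  proof -
    obtain q where "q \<in> U" "q \<in> chart_dom c" "x = chart_map c q" using x by blast
    then show ?thesis using assms(3)[of q] chart_inv_chart_map[OF c, of q] by simp
  qed
  show "smooth_function A U w"
    unfolding smooth_function_def smooth_components_def
  proof
    fix c assume c: "c \<in> A"
    let ?W = "chart_map c ` (U \<inter> chart_dom c)"
    have "smooth_on ?W (\<lambda>x. u (chart_inv c x))"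
      using assms(2) c unfolding smooth_function_def smooth_components_def by blast
    then have "smooth_on ?W (\<lambda>x. u (chart_inv c x) + k)"
      unfolding smooth_on_def using Ck_on_add[OF open_chart_image[OF c assms(1)] _ Ck_on_const] by blast
    then show "smooth_on ?W (\<lambda>x. w (chart_inv c x))"
      by (rule smooth_on_cong[OF open_chart_image[OF c assms(1)] eq[OF c], rotated])
  qed
  assume c: "c \<in> A" and q: "q \<in> U" "q \<in> chart_dom c"
  have "((\<lambda>x. u (chart_inv c x) + k) has_derivative differential u c q) (at (chart_map c q))"
    using has_derivative_add[OF smooth_function_has_derivative[OF assms(2) c q] has_derivative_const] by simp
  then have "((\<lambda>x. w (chart_inv c x)) has_derivative differential u c q) (at (chart_map c q))"
    by (rule has_derivative_transform_within_open[OF _ open_chart_image[OF c assms(1)] _ eq[OF c]])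
      (use q in auto)
  then show "differential w c q v = differential u c q v" by (rule differential_eqI)
qed

end

section \<open>Conformal deformations and the Lee form\<close>

lemma fundamental_form_conformal_deformation:
  "fundamental_form (conformal_deformation f S) = (\<lambda>c p. f p *\<^sub>R fundamental_form S c p)"
  by (intro ext blinfun_eqI) (simp add: fundamental_form_def conformal_deformation_def blinfun.scaleR_left)

lemma has_signature_scaleR:
  assumes "k > 0" "has_signature B r s"
  shows "has_signature (k *\<^sub>R B) r s"
  using assms unfolding has_signature_def
  by (auto simp: blinfun.scaleR_left zero_less_mult_iff mult_less_0_iff)

locale almost_alpha_paracosymplectic_manifold = smooth_manifold A
  for A :: "('m::{t2_space,second_countable_topology}, 'e::euclidean_space) chart set" +
  fixes S :: "('m, 'e) paracontact_data" and \<alpha> :: "'m \<Rightarrow> real" and n :: nat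
  assumes DIM: "DIM('e) = 2 * n + 1" and n_ge_2: "n \<ge> 2"
    and alpha_structure: "almost_alpha_paracosymplectic A n UNIV \<alpha> S"
begin

lemma smooth_alpha: "smooth_function A UNIV \<alpha>"
  and almost_paracontact_S: "almost_paracontact A n UNIV S"
  and phi_field: "endomorphism_field A UNIV (phi S)"
  and xi_field: "vector_field A UNIV (xi S)"
  and eta_field: "one_form A UNIV (eta S)"
  and met_field: "pseudo_riemannian_metric A UNIV (n + 1) n (met S)"
  using alpha_structure unfolding almost_alpha_paracosymplectic_def almost_paracontact_metric_def
    almost_paracontact_def by blast+

lemma almost_paracontact_metric_S: "almost_paracontact_metric A n UNIV S"
  using alpha_structure unfolding almost_alpha_paracosymplectic_def by blast

lemma smooth_phi: "smooth_components A UNIV (phi S)"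
  and smooth_xi: "smooth_components A UNIV (xi S)"
  and smooth_eta: "smooth_components A UNIV (eta S)"
  and smooth_met: "smooth_components A UNIV (met S)"
  using phi_field xi_field eta_field met_field unfolding endomorphism_field_def vector_field_def one_form_def
    pseudo_riemannian_metric_def bilinear_field_def by blast+

lemma smooth_fundamental: "smooth_components A UNIV (fundamental_form S)"
  using smooth_components_bilinear[OF bounded_bilinear_blinfun_compose open_UNIV smooth_met smooth_phi]
  unfolding fundamental_form_def[abs_def] .

lemma fundamental_apply:
  "blinfun_apply (blinfun_apply (fundamental_form S c q) v) w =
   blinfun_apply (blinfun_apply (met S c q) (blinfun_apply (phi S c q) v)) w"
  by (simp add: fundamental_form_def)

lemma tangent_space:
  assumes "c \<in> A" "q \<in> chart_dom c"
  shows "paracontact_metric_vector_space (phi S c q) (xi S c q) (eta S c q) (met S c q)"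
proof
  have q: "q \<in> UNIV \<inter> chart_dom c" using assms(2) by simp
  show "eta S c q (xi S c q) = 1"
    "\<And>v. phi S c q (phi S c q v) = v - eta S c q v *\<^sub>R xi S c q"
    using almost_paracontact_S assms(1) q unfolding almost_paracontact_def by blast+
  show "\<And>v w. met S c q (phi S c q v) (phi S c q w) = - met S c q v w + eta S c q v * eta S c q w"
    using almost_paracontact_metric_S assms(1) q unfolding almost_paracontact_metric_def by blast
  have g: "\<And>v w. met S c q v w = met S c q w v" "has_signature (met S c q) (n + 1) n"
    using met_field assms(1) q unfolding pseudo_riemannian_metric_def by blast+
  then show "\<And>v w. met S c q v w = met S c q w v" by blast
  show "v = 0" if "\<And>w. met S c q v w = 0" for v
    using has_signature_nondegenerate[OF g(2,1) that] .
qed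

lemma d_eta: "c \<in> A \<Longrightarrow> q \<in> chart_dom c \<Longrightarrow> ext_deriv1 (eta S) c q v w = 0"
  and d_fundamental: "c \<in> A \<Longrightarrow> q \<in> chart_dom c \<Longrightarrow>
    ext_deriv2 (fundamental_form S) c q x y z = 2 * \<alpha> q * wedge12 (eta S) (fundamental_form S) c q x y z"
  using alpha_structure unfolding almost_alpha_paracosymplectic_def by blast+

text \<open>With \<open>f = exp (- 2 u)\<close> one has \<open>df = - 2 f du\<close>, so \<open>d (f \<eta>) = - 2 f du \<and> \<eta>\<close> and
  \<open>d (f \<Phi>) = 2 f (\<alpha> \<eta> - du) \<and> \<Phi>\<close>. The factor 2 in the exponent is the one in
  \<open>d\<Phi> = 2 \<alpha> \<eta> \<and> \<Phi>\<close>.\<close>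

lemma ext_deriv1_deformed_eta:
  assumes "open U" "smooth_function A U u" "c \<in> A" "q \<in> U" "q \<in> chart_dom c"
  shows "ext_deriv1 (eta (conformal_deformation (\<lambda>p. exp (- 2 * u p)) S)) c q v w =
    - 2 * exp (- 2 * u q) * (differential u c q v * eta S c q w - differential u c q w * eta S c q v)"
proof -
  have "ext_deriv1 (\<lambda>c p. exp (- 2 * u p) *\<^sub>R eta S c p) c q v w =
      exp (- 2 * u q) * ext_deriv1 (eta S) c q v w
      - 2 * exp (- 2 * u q) * (differential u c q v * eta S c q w - differential u c q w * eta S c q v)"
    unfolding ext_deriv1_def coord_deriv_scaleR[OF smooth_function_exp[OF assms(1,2)]
        smooth_components_subset[OF smooth_eta subset_UNIV] assms(3-5)] differential_exp[OF assms(2-5)]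
    by (simp add: blinfun.add_left blinfun.diff_left blinfun.scaleR_left algebra_simps)
  then show ?thesis
    using d_eta[OF assms(3,5)] by (simp add: conformal_deformation_def)
qed

lemma ext_deriv2_deformed_fundamental:
  assumes "open U" "smooth_function A U u" "c \<in> A" "q \<in> U" "q \<in> chart_dom c"
  defines "\<beta> \<equiv> \<lambda>v. \<alpha> q * eta S c q v - differential u c q v"
    and "\<Phi> \<equiv> fundamental_form S c q"
  shows "ext_deriv2 (fundamental_form (conformal_deformation (\<lambda>p. exp (- 2 * u p)) S)) c q x y z =
    2 * exp (- 2 * u q) * (\<beta> x * \<Phi> y z + \<beta> y * \<Phi> z x + \<beta> z * \<Phi> x y)"
proof -
  have "ext_deriv2 (\<lambda>c p. exp (- 2 * u p) *\<^sub>R fundamental_form S c p) c q x y z =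
      exp (- 2 * u q) * ext_deriv2 (fundamental_form S) c q x y z - 2 * exp (- 2 * u q) *
       (differential u c q x * \<Phi> y z + differential u c q y * \<Phi> z x + differential u c q z * \<Phi> x y)"
    unfolding \<Phi>_def ext_deriv2_def coord_deriv_scaleR[OF smooth_function_exp[OF assms(1,2)]
        smooth_components_subset[OF smooth_fundamental subset_UNIV] assms(3-5)] differential_exp[OF assms(2-5)]
    by (simp add: blinfun.add_left blinfun.diff_left blinfun.scaleR_left algebra_simps)
  then show ?thesis
    unfolding fundamental_form_conformal_deformation d_fundamental[OF assms(3,5)]
    by (simp add: \<beta>_def \<Phi>_def wedge12_def algebra_simps)
qed

lemma conformal_deformation_almost_paracontact:
  assumes "open U" "smooth_function A U u"
  shows "almost_paracontact A n U (conformal_deformation (\<lambda>p. exp (- 2 * u p)) S)"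
  unfolding almost_paracontact_def
proof (intro conjI)
  let ?S = "conformal_deformation (\<lambda>p. exp (- 2 * u p)) S"
  note sf = smooth_function_exp[OF assms]
  show "endomorphism_field A U (phi ?S)"
    using phi_field smooth_components_subset[OF smooth_phi subset_UNIV]
    unfolding endomorphism_field_def by (simp add: conformal_deformation_def)
  have sm: "smooth_components A U (\<lambda>c p. (1 / exp (- 2 * u p)) *\<^sub>R xi S c p)"
    using smooth_components_scaleR[OF assms(1) sf[of 2] smooth_components_subset[OF smooth_xi subset_UNIV]]
    by (simp add: exp_minus field_simps)
  have tr: "k *\<^sub>R xi S c' p = transition_deriv c c' p (k *\<^sub>R xi S c p)"
    if "c \<in> A" "c' \<in> A" "p \<in> chart_dom c" "p \<in> chart_dom c'" for c c' p k
  proof -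
    have "linear (transition_deriv c c' p)"
      using transition_has_derivative[OF that] has_derivative_linear by blast
    moreover have "xi S c' p = transition_deriv c c' p (xi S c p)"
      using xi_field that unfolding vector_field_def by blast
    ultimately show ?thesis by (simp add: linear_cmul)
  qed
  show "vector_field A U (xi ?S)"
    unfolding vector_field_def
  proof (intro conjI ballI)
    show "smooth_components A U (xi ?S)" using sm by (simp add: conformal_deformation_def)
    show "xi ?S c' p = transition_deriv c c' p (xi ?S c p)"
      if "c \<in> A" "c' \<in> A" "p \<in> U \<inter> chart_dom c \<inter> chart_dom c'" for c c' p
      using tr[of c c' p] that by (simp only: conformal_deformation_def paracontact_data.simps Int_iff)
  qed
  have "smooth_components A U (\<lambda>c p. exp (- 2 * u p) *\<^sub>R eta S c p)"
    by (rule smooth_components_scaleR[OF assms(1) sf smooth_components_subset[OF smooth_eta subset_UNIV]])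
  then show "one_form A U (eta ?S)"
    using eta_field unfolding one_form_def by (simp add: conformal_deformation_def blinfun.scaleR_left)
  show "\<forall>c\<in>A. \<forall>p\<in>U \<inter> chart_dom c.
       blinfun_apply (eta ?S c p) (xi ?S c p) = 1 \<and>
       (\<forall>v. blinfun_apply (phi ?S c p) (blinfun_apply (phi ?S c p) v) =
            v - blinfun_apply (eta ?S c p) v *\<^sub>R xi ?S c p) \<and>
       dim {v. blinfun_apply (eta ?S c p) v = 0 \<and> blinfun_apply (phi ?S c p) v = v} = n \<and>
       dim {v. blinfun_apply (eta ?S c p) v = 0 \<and> blinfun_apply (phi ?S c p) v = - v} = n"
    using almost_paracontact_S unfolding almost_paracontact_def
    by (simp add: conformal_deformation_def blinfun.scaleR_left blinfun.scaleR_right)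
qed

lemma conformal_deformation_metric:
  assumes "open U" "smooth_function A U u"
  shows "pseudo_riemannian_metric A U (n + 1) n (met (conformal_deformation (\<lambda>p. exp (- 2 * u p)) S))"
proof -
  have "smooth_components A U (\<lambda>c p. exp (- 2 * u p) *\<^sub>R met S c p)"
    by (rule smooth_components_scaleR[OF assms(1) smooth_function_exp[OF assms]
          smooth_components_subset[OF smooth_met subset_UNIV]])
  then show ?thesis
    using met_field unfolding pseudo_riemannian_metric_def bilinear_field_def
    by (simp add: conformal_deformation_def blinfun.scaleR_left has_signature_scaleR)
qed

lemma conformal_deformation_compatible:
  fixes u defines "S' \<equiv> conformal_deformation (\<lambda>p. exp (- 2 * u p)) S"
  assumes "c \<in> A" "q \<in> chart_dom c"
  shows "met S' c q (phi S' c q v) (phi S' c q w) =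
    - met S' c q v w + met S' c q (xi S' c q) (xi S' c q) * (eta S' c q v * eta S' c q w)"
proof -
  interpret paracontact_metric_vector_space "phi S c q" "xi S c q" "eta S c q" "met S c q"
    by (rule tangent_space[OF assms(2,3)])
  show ?thesis
    unfolding S'_def
    by (simp add: conformal_deformation_def blinfun.scaleR_left blinfun.scaleR_right compatible g_xi eta_xi
        field_simps)
qed

text \<open>If \<open>du = \<alpha> \<eta>\<close>, both exterior derivatives of the deformed forms vanish. Conversely
  \<open>d (f \<Phi>) = 0\<close> means \<open>(\<alpha> \<eta> - du) \<and> \<Phi> = 0\<close>, and wedging with \<open>\<Phi>\<close> is injective.
  The potentials are thus exactly the primitives of the 1-form \<open>\<alpha> \<eta>\<close>, from which existence,
  uniqueness and the formula for \<open>du\<close> are read off.\<close>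

lemma paracosymplectic_potential_iff:
  assumes "open U"
  shows "paracosymplectic_potential A n S U u \<longleftrightarrow> smooth_function A U u \<and>
    (\<forall>c\<in>A. \<forall>q\<in>U \<inter> chart_dom c. \<forall>v. \<alpha> q * eta S c q v = differential u c q v)"
    (is "?pot \<longleftrightarrow> ?smooth \<and> ?lee")
proof -
  let ?S = "conformal_deformation (\<lambda>p. exp (- 2 * u p)) S"
  have "?lee" if pot: ?pot
  proof (intro ballI allI)
    fix c q v assume c: "c \<in> A" and "q \<in> U \<inter> chart_dom c"
    then have q: "q \<in> U" "q \<in> chart_dom c" by auto
    have u: "smooth_function A U u" using pot unfolding paracosymplectic_potential_def by blast
    interpret paracontact_metric_vector_space "phi S c q" "xi S c q" "eta S c q" "met S c q"
      by (rule tangent_space[OF c q(2)])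
    define \<beta> where "\<beta> v = \<alpha> q * eta S c q v - differential u c q v" for v
    have "ext_deriv2 (fundamental_form ?S) c q x y z = 0" for x y z
      using pot c q unfolding paracosymplectic_potential_def almost_paracosymplectic_def by blast
    then have w: "\<beta> x * met S c q (phi S c q y) z + \<beta> y * met S c q (phi S c q z) x
        + \<beta> z * met S c q (phi S c q x) y = 0" for x y z
      unfolding ext_deriv2_deformed_fundamental[OF assms u c q] \<beta>_def fundamental_apply by simp
    have "linear (differential u c q)"
      using smooth_function_has_derivative[OF u c q] has_derivative_linear by blast
    then have "linear \<beta>"
      unfolding \<beta>_def
      by (auto intro!: linearI simp: linear_add linear_cmul blinfun.add_right blinfun.scaleR_right algebra_simps)
    from wedge_fundamental_eq_zero[OF this _ w] show "\<alpha> q * eta S c q v = differential u c q v"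
      using DIM n_ge_2 by (simp add: \<beta>_def)
  qed
  moreover have ?pot if u: ?smooth and lee: ?lee
    unfolding paracosymplectic_potential_def almost_paracosymplectic_def
  proof (intro conjI ballI u conformal_deformation_almost_paracontact[OF assms u]
      conformal_deformation_metric[OF assms u])
    fix c q assume c: "c \<in> A" and "q \<in> U \<inter> chart_dom c"
    then have q: "q \<in> U" "q \<in> chart_dom c" by auto
    have d: "differential u c q v = \<alpha> q * eta S c q v" for v
      using lee c q by simp
    show "\<forall>v w. met ?S c q (phi ?S c q v) (phi ?S c q w) =
       - met ?S c q v w + met ?S c q (xi ?S c q) (xi ?S c q) * (eta ?S c q v * eta ?S c q w)"
      using conformal_deformation_compatible[OF c q(2)] by blast
    show "\<forall>v w. ext_deriv1 (eta ?S) c q v w = 0"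
      unfolding ext_deriv1_deformed_eta[OF assms u c q] d by simp
    show "\<forall>x y z. ext_deriv2 (fundamental_form ?S) c q x y z = 0"
      unfolding ext_deriv2_deformed_fundamental[OF assms u c q] d by simp
  qed
  ultimately show ?thesis unfolding paracosymplectic_potential_def by blast
qed

text \<open>Inserting \<open>\<xi>\<close> into \<open>d\<alpha> \<and> \<eta> \<and> \<Phi> = 0\<close> gives
  \<open>(d\<alpha> - d\<alpha>(\<xi>) \<eta>) \<and> \<Phi> = 0\<close>, since \<open>\<eta>(\<xi>) = 1\<close> and \<open>\<Phi>(\<xi>, \<cdot>) = 0\<close>. Injectivity of the
  wedge product with \<open>\<Phi>\<close> removes the 1-form in parentheses. In particular \<open>d\<alpha> \<and> \<eta> = 0\<close>,
  which together with \<open>d\<eta> = 0\<close> says that \<open>\<alpha> \<eta>\<close> is closed.\<close>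

lemma d_alpha_proportional_eta:
  assumes c: "c \<in> A" and q: "q \<in> chart_dom c"
  shows "differential \<alpha> c q v = differential \<alpha> c q (xi S c q) * eta S c q v"
proof -
  interpret paracontact_metric_vector_space "phi S c q" "xi S c q" "eta S c q" "met S c q"
    by (rule tangent_space[OF c q])
  let ?W = "chart_map c ` chart_dom c" and ?i = "chart_inv c"
  note sm = smooth_components_chart[of UNIV, OF _ c, simplified]
  define \<beta> where "\<beta> v = differential \<alpha> c q v - differential \<alpha> c q (xi S c q) * eta S c q v" for v
  have anti: "fundamental_form S c (?i x) v w = - fundamental_form S c (?i x) w v" if x: "x \<in> ?W" for x v w
  proof -
    obtain r where r: "r \<in> chart_dom c" "x = chart_map c r" using x by blast
    show ?thesis
      unfolding fundamental_apply r(2) chart_inv_chart_map[OF c r(1)]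
      by (rule paracontact_metric_vector_space.fundamental_antisym[OF tangent_space[OF c r(1)]])
  qed
  have cl: "blinfun_apply (frechet_derivative (\<lambda>x. eta S c (?i x)) (at x) v) w =
      blinfun_apply (frechet_derivative (\<lambda>x. eta S c (?i x)) (at x) w) v" if "x \<in> ?W" for x v w
    using that d_eta[OF c] by (auto simp: ext_deriv1_def coord_deriv_def)
  have dP: "blinfun_apply (blinfun_apply (frechet_derivative (\<lambda>x. fundamental_form S c (?i x)) (at r) x) y) z +
      blinfun_apply (blinfun_apply (frechet_derivative (\<lambda>x. fundamental_form S c (?i x)) (at r) y) z) x +
      blinfun_apply (blinfun_apply (frechet_derivative (\<lambda>x. fundamental_form S c (?i x)) (at r) z) x) y =
      2 * \<alpha> (?i r) * (eta S c (?i r) x * fundamental_form S c (?i r) y z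
        + eta S c (?i r) y * fundamental_form S c (?i r) z x + eta S c (?i r) z * fundamental_form S c (?i r) x y)"
    if "r \<in> ?W" for r x y z
    using that d_fundamental[OF c]
    by (auto simp: ext_deriv2_def wedge12_def coord_deriv_def chart_inv_chart_map[OF c])
  have i: "?i (chart_map c q) = q" by (rule chart_inv_chart_map[OF c q])
  have d: "frechet_derivative (\<lambda>x. \<alpha> (?i x)) (at (chart_map c q)) = differential \<alpha> c q"
    unfolding differential_def[abs_def] coord_deriv_def ..
  note main = d_alpha_wedge_eta_wedge_fundamental[OF open_chart_range[OF c] sm[OF smooth_eta] sm[OF smooth_fundamental]
      sm[OF smooth_alpha[unfolded smooth_function_def]] imageI[OF q] anti cl dP, unfolded d i fundamental_apply]
  have "linear (differential \<alpha> c q)"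
    using smooth_function_has_derivative[OF smooth_alpha c UNIV_I q] has_derivative_linear by blast
  then have lin: "linear \<beta>"
    unfolding \<beta>_def
    by (auto intro!: linearI simp: linear_add linear_cmul blinfun.add_right blinfun.scaleR_right algebra_simps)
  have w: "\<beta> x * met S c q (phi S c q y) z + \<beta> y * met S c q (phi S c q z) x
        + \<beta> z * met S c q (phi S c q x) y = 0" for x y z
    using main[of "xi S c q" x y z] fundamental_antisym[of x z]
    by (simp add: \<beta>_def fundamental_xi eta_xi algebra_simps)
  have "\<beta> v = 0"
    by (rule wedge_fundamental_eq_zero[OF lin _ w]) (use DIM n_ge_2 in linarith)
  then show ?thesis by (simp add: \<beta>_def)
qed

text \<open>A primitive of the closed form \<open>\<alpha> \<eta>\<close> on a coordinate ball. In any other chart the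
  transformation law of \<open>\<eta>\<close> shows that its derivative is again \<open>\<alpha> \<eta>\<close>, so it is smooth there as
  the primitive of a smooth form.\<close>

lemma local_potential:
  obtains U u where "open U" "connected U" "p \<in> U" "paracosymplectic_potential A n S U u"
proof -
  obtain c where c: "c \<in> A" "p \<in> chart_dom c" by (rule obtain_chart)
  let ?W = "chart_map c ` chart_dom c" and ?i = "chart_inv c"
  obtain r where r: "r > 0" "ball (chart_map c p) r \<subseteq> ?W"
    using open_chart_range[OF c(1)] c(2) openE by blast
  let ?B = "ball (chart_map c p) r"
  note sm = smooth_components_chart[of UNIV, OF _ c(1), simplified]
  let ?\<beta> = "\<lambda>c p. \<alpha> p *\<^sub>R eta S c p"
  have sb: "smooth_components A UNIV ?\<beta>"
    by (rule smooth_components_scaleR[OF open_UNIV smooth_alpha smooth_eta])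
  have sB: "smooth_on ?B (\<lambda>x. ?\<beta> c (?i x))"
    using smooth_on_subset[OF sm[OF sb] r(2)] .
  obtain u where u: "\<And>x. x \<in> ?B \<Longrightarrow> (u has_derivative blinfun_apply (?\<beta> c (?i x))) (at x)"
  proof (rule poincare_convex[OF open_ball convex_ball centre_in_ball[THEN iffD2, OF r(1)]])
    fix x v w assume x: "x \<in> ?B"
    then obtain q where q: "q \<in> chart_dom c" "x = chart_map c q" using r(2) by blast
    have D: "frechet_derivative (\<lambda>x. ?\<beta> c (?i x)) (at x) v = \<alpha> q *\<^sub>R coord_deriv c (eta S) q v
       + differential \<alpha> c q v *\<^sub>R eta S c q" for v
      using coord_deriv_scaleR[OF smooth_alpha smooth_eta c(1) UNIV_I q(1)]
      unfolding coord_deriv_def q(2) by simp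
    show "blinfun_apply (frechet_derivative (\<lambda>x. ?\<beta> c (?i x)) (at x) v) w =
        blinfun_apply (frechet_derivative (\<lambda>x. ?\<beta> c (?i x)) (at x) w) v"
      using d_eta[OF c(1) q(1), of v w] unfolding D d_alpha_proportional_eta[OF c(1) q(1), of v] d_alpha_proportional_eta[OF c(1) q(1), of w]
      by (simp add: ext_deriv1_def blinfun.add_left blinfun.scaleR_left)
  next
    fix x assume "x \<in> ?B"
    then show "((\<lambda>x. ?\<beta> c (?i x)) has_derivative frechet_derivative (\<lambda>x. ?\<beta> c (?i x)) (at x)) (at x)"
      by (rule smooth_on_has_derivative[OF sB])
  next
    fix v show "continuous_on ?B (\<lambda>x. frechet_derivative (\<lambda>x. ?\<beta> c (?i x)) (at x) v)"
      by (rule smooth_on_imp_continuous_on[OF smooth_on_deriv[OF sB]])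
  qed blast
  define U where "U = ?i ` ?B"
  have U: "q \<in> chart_dom c" "chart_map c q \<in> ?B" if "q \<in> U" for q
    using that r(2) chart_inv_chart_map[OF c(1)] unfolding U_def by force+
  note hom = homeomorphism_symD[OF chart_homeomorphism[OF c(1)]]
  have "openin (top_of_set (chart_dom c)) U"
    unfolding U_def by (rule homeomorphism_imp_open_map[OF hom]) (use r(2) in \<open>auto intro: open_subset\<close>)
  then have oU: "open U" using open_chart_dom[OF c(1)] openin_open_trans by blast
  have "continuous_on ?B ?i"
    using hom r(2) unfolding homeomorphism_def by (meson continuous_on_subset)
  then have cU: "connected U" unfolding U_def by (intro connected_continuous_image) auto
  have pU: "p \<in> U"
    unfolding U_def using chart_inv_chart_map[OF c] r(1) by (metis centre_in_ball imageI)
  let ?u = "\<lambda>q. u (chart_map c q)"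
  have der: "((\<lambda>x. ?u (chart_inv c' x)) has_derivative (\<lambda>v. \<alpha> q * eta S c' q v)) (at (chart_map c' q))"
    if "c' \<in> A" "q \<in> U" "q \<in> chart_dom c'" for c' q
  proof -
    note q = U[OF that(2)]
    have u': "(u has_derivative blinfun_apply (?\<beta> c q)) (at (chart_map c (chart_inv c' (chart_map c' q))))"
      using u[OF q(2)] chart_inv_chart_map[OF c(1) q(1)] chart_inv_chart_map[OF that(1,3)] by simp
    have "eta S c q (transition_deriv c' c q v) = eta S c' q v" for v
      using eta_field c(1) that q(1) unfolding one_form_def by blast
    then show ?thesis
      using has_derivative_compose[OF transition_has_derivative[OF that(1) c(1) that(3) q(1)] u']
      by (simp add: blinfun.scaleR_left)
  qed
  have "smooth_function A U ?u"
    unfolding smooth_function_def smooth_components_def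
  proof
    fix c' assume c': "c' \<in> A"
    let ?W' = "chart_map c' ` (U \<inter> chart_dom c')"
    note oW' = open_chart_image[OF c' oU]
    show "smooth_on ?W' (\<lambda>x. ?u (chart_inv c' x))"
    proof (rule smooth_on_antiderivative[OF oW'])
      fix x assume "x \<in> ?W'"
      then obtain q where q: "q \<in> U" "q \<in> chart_dom c'" "x = chart_map c' q" by blast
      show "((\<lambda>x. ?u (chart_inv c' x)) has_derivative blinfun_apply (?\<beta> c' (chart_inv c' x))) (at x)"
        using der[OF c' q(1,2)] unfolding q(3) chart_inv_chart_map[OF c' q(2)]
        by (simp add: blinfun.scaleR_left[abs_def])
    next
      fix v show "smooth_on ?W' (\<lambda>x. blinfun_apply (?\<beta> c' (chart_inv c' x)) v)"
        by (intro smooth_on_blinfun_apply[OF oW'] smooth_components_chart[OF _ c']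
            smooth_components_subset[OF sb subset_UNIV])
    qed
  qed
  moreover have "\<forall>c\<in>A. \<forall>q\<in>U \<inter> chart_dom c. \<forall>v. \<alpha> q * eta S c q v = differential ?u c q v"
    using differential_eqI[OF der] by simp
  ultimately have "paracosymplectic_potential A n S U ?u"
    using paracosymplectic_potential_iff[OF oU] by blast
  then show thesis using that oU cU pU by blast
qed

lemma potential_unique:
  assumes "open U" "connected U" "paracosymplectic_potential A n S U u"
  shows "paracosymplectic_potential A n S U w \<longleftrightarrow> (\<exists>k. \<forall>q\<in>U. w q = u q + k)"
proof
  note iff = paracosymplectic_potential_iff[OF assms(1)]
  assume w: "paracosymplectic_potential A n S U w"
  have su: "smooth_function A U u" and sw: "smooth_function A U w"
    using assms(3) w unfolding iff by blast+
  \<comment> \<open>The difference has derivative zero in every chart, hence is itself smooth.\<close>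
  define f where "f q = w q + (- 1) * u q" for q
  have hd: "((\<lambda>x. f (chart_inv c x)) has_derivative (\<lambda>v. 0)) (at (chart_map c q))"
    if "c \<in> A" "q \<in> U" "q \<in> chart_dom c" for c q
  proof -
    have "differential w c q = differential u c q"
      using assms(3) w that unfolding iff by (metis IntI ext)
    then show ?thesis
      unfolding f_def
      using has_derivative_diff[OF smooth_function_has_derivative[OF sw that] smooth_function_has_derivative[OF su that]]
      by simp
  qed
  have "smooth_function A U f"
    unfolding smooth_function_def smooth_components_def
  proof
    fix c assume c: "c \<in> A"
    show "smooth_on (chart_map c ` (U \<inter> chart_dom c)) (\<lambda>x. f (chart_inv c x))"
      by (rule smooth_on_antiderivative[OF open_chart_image[OF c assms(1)], where f' = "\<lambda>_ _. 0"])
        (use hd[OF c] in \<open>auto intro: smooth_on_const\<close>)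
  qed
  then have "f constant_on U"
    by (rule constant_of_zero_differential[OF assms(1,2)]) (rule differential_eqI[OF hd])
  then obtain k where "\<forall>q\<in>U. f q = k" unfolding constant_on_def by blast
  then show "\<exists>k. \<forall>q\<in>U. w q = u q + k" by (intro exI[of _ k]) (auto simp: f_def)
next
  note iff = paracosymplectic_potential_iff[OF assms(1)]
  assume "\<exists>k. \<forall>q\<in>U. w q = u q + k"
  then obtain k where k: "\<And>q. q \<in> U \<Longrightarrow> w q = u q + k" by blast
  have su: "smooth_function A U u" using assms(3) unfolding iff by blast
  have sw: "smooth_function A U w"
    by (rule smooth_function_differential_add_const(1)[OF assms(1) su k])
  show "paracosymplectic_potential A n S U w"
    unfolding iff
  proof (intro conjI ballI allI sw)
    fix c q v assume c: "c \<in> A" and q: "q \<in> U \<inter> chart_dom c"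
    have "\<alpha> q * eta S c q v = differential u c q v"
      using assms(3) c q unfolding iff by blast
    then show "\<alpha> q * eta S c q v = differential w c q v"
      using smooth_function_differential_add_const(2)[OF assms(1) su, of w k c q v, OF k] c q
      by (simp only: Int_iff)
  qed
qed

lemma locally_conformal: "locally_conformal_to_almost_paracosymplectic A n S"
  unfolding locally_conformal_to_almost_paracosymplectic_def
proof (intro exI[of _ "{U. open U \<and> (\<exists>u. paracosymplectic_potential A n S U u)}"] conjI ballI)
  let ?C = "{U. open U \<and> (\<exists>u. paracosymplectic_potential A n S U u)}"
  show "open U" if "U \<in> ?C" for U using that by blast
  have "p \<in> \<Union> ?C" for p
  proof -
    obtain U u where "open U" "p \<in> U" "paracosymplectic_potential A n S U u"
      by (rule local_potential[of p])
    then show ?thesis by blast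
  qed
  then show "\<Union> ?C = UNIV" by blast
  fix U assume "U \<in> ?C"
  then obtain u where U: "open U" and u: "smooth_function A U u"
    "almost_paracosymplectic A n U (conformal_deformation (\<lambda>p. exp (- 2 * u p)) S)"
    unfolding paracosymplectic_potential_def by blast
  have "conformal A U S (conformal_deformation (\<lambda>p. exp (- 2 * u p)) S)"
    unfolding conformal_def
    using smooth_function_exp[OF U u(1), of "- 2"]
    by (intro exI[of _ "\<lambda>p. exp (- 2 * u p)"]) (simp add: conformal_deformation_def)
  with u(2) show "\<exists>S'. almost_paracosymplectic A n U S' \<and> conformal A U S S'" by blast
qed

end

theorem theorem10:
  fixes A :: "('m::{t2_space,second_countable_topology}, 'e::euclidean_space) chart set"
    and S :: "('m, 'e) paracontact_data"
    and \<alpha> :: "'m \<Rightarrow> real"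
    and n :: nat
  assumes "smooth_atlas A"
    and "DIM('e) = 2 * n + 1"
    and "n \<ge> 2"
    and "almost_alpha_paracosymplectic A n UNIV \<alpha> S"
  shows "locally_conformal_to_almost_paracosymplectic A n S \<and>
    (\<forall>p. \<exists>U u. open U \<and> connected U \<and> p \<in> U \<and> paracosymplectic_potential A n S U u) \<and>
    (\<forall>U u. open U \<and> paracosymplectic_potential A n S U u \<longrightarrow>
       (\<forall>c\<in>A. \<forall>q\<in>U \<inter> chart_dom c. \<forall>v.
          \<alpha> q * blinfun_apply (eta S c q) v = differential u c q v)) \<and>
    (\<forall>U u w. open U \<and> connected U \<and> paracosymplectic_potential A n S U u \<longrightarrow>
       (paracosymplectic_potential A n S U w \<longleftrightarrow> (\<exists>k. \<forall>q\<in>U. w q = u q + k)))"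
proof -
  interpret almost_alpha_paracosymplectic_manifold A S \<alpha> n
    using assms by unfold_locales
  show ?thesis
  proof (intro conjI allI impI)
    show "locally_conformal_to_almost_paracosymplectic A n S" by (rule locally_conformal)
    show "\<exists>U u. open U \<and> connected U \<and> p \<in> U \<and> paracosymplectic_potential A n S U u" for p
      by (rule local_potential[of p]) blast
    show "\<forall>c\<in>A. \<forall>q\<in>U \<inter> chart_dom c. \<forall>v. \<alpha> q * blinfun_apply (eta S c q) v = differential u c q v"
      if "open U \<and> paracosymplectic_potential A n S U u" for U u
      using that paracosymplectic_potential_iff by blast
    show "paracosymplectic_potential A n S U w \<longleftrightarrow> (\<exists>k. \<forall>q\<in>U. w q = u q + k)"
      if "open U \<and> connected U \<and> paracosymplectic_potential A n S U u" for U u w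
      using that potential_unique by blast
  qed
qed

end
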